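(* Let $G$ be a compact (Hausdorff) group and let $\mathfrak K=(\mathfrak E,\mathrm R,D)$ be an L-coherent coabelian classification datum for $G$. Let $C^{\mathfrak E}/\Phi$ be a representation of $\mathfrak E$. If $\theta:\mathrm{Hom}(D^{\mathfrak E},\Pi_{\mathfrak K})\to C^{\mathfrak E}/\Phi$ is an isomorphism in $\mathsf{Fct}(\mathfrak E,\mathsf{TAb})$, then it is already a $\mathfrak K$-class field theory; that is, for every $\mathrm R$-lattice $\mathcal L$ in $\mathfrak E$ and every $H\in\mathfrak E^\flat_{\mathrm b}$, the map $\Phi(H,-)|_{\mathcal L(H)}$ from $\mathcal L(H)$ to the lattice of subgroups of $C(H)$ is an injective morphism of lattices (with respect to products and intersections).
   Context: $\mathsf{TAb}$ is the category of topological abelian groups (not necessarily Hausdorff); compact and locally compact include Hausdorff. ${}^gH=gHg^{-1}$. RIC-functors. A RIC-domain $\mathfrak D$ consists of a non-empty set $\mathfrak D_{\mathrm b}$ with a left action $(g,x)\mapsto{}^gx$ of a group $G$ and, for each $x\in\mathfrak D_{\mathrm b}$, subsets $\mathfrak D_{\mathrm r}(x),\mathfrak D_{\mathrm i}(x)\subseteq\mathfrak D_{\mathrm b}$ such that for $\star\in\{\mathrm r,\mathrm i\}$: $x\in\mathfrak D_\star(x)$; $y\in\mathfrak D_\star(x)$ implies $\mathfrak D_\star(y)\subseteq\mathfrak D_\star(x)$; ${}^g\mathfrak D_\star(x)=\mathfrak D_\star({}^gx)$. A RIC-functor $\Phi:\mathfrak D\to\mathcal C$ into a category $\mathcal C$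 consists of objects $\Phi(x)$ and morphisms $\mathrm{res}_{y,x}:\Phi(x)\to\Phi(y)$ ($y\in\mathfrak D_{\mathrm r}(x)$), $\mathrm{ind}_{x,y}:\Phi(y)\to\Phi(x)$ ($y\in\mathfrak D_{\mathrm i}(x)$), $\mathrm{con}_{g,x}:\Phi(x)\to\Phi({}^gx)$ ($g\in G$) such that $\mathrm{res}_{x,x}=\mathrm{ind}_{x,x}=\mathrm{con}_{1,x}=\mathrm{id}$; $\mathrm{res}_{z,y}\mathrm{res}_{y,x}=\mathrm{res}_{z,x}$, $\mathrm{ind}_{x,y}\mathrm{ind}_{y,z}=\mathrm{ind}_{x,z}$, $\mathrm{con}_{g',{}^gx}\mathrm{con}_{g,x}=\mathrm{con}_{g'g,x}$; $\mathrm{con}_{g,y}\mathrm{res}_{y,x}=\mathrm{res}_{{}^gy,{}^gx}\mathrm{con}_{g,x}$ and $\mathrm{con}_{g,x}\mathrm{ind}_{x,y}=\mathrm{ind}_{{}^gx,{}^gy}\mathrm{con}_{g,y}$. Morphisms are families $(\varphi_x)$ of morphisms commuting with res, ind, con; the category is $\mathsf{Fct}(\mathfrak D,\mathcal C)$. For $\Phi\in\mathsf{Fct}(\mathfrak D,\mathsf{TAb})$ a subfunctor is a family of subgroups $\Phi'(x)\le\Phi(x)$ stable under res, ind, con; the quotient functor $\Phi/\Phi'$ has values $\Phi(x)/\Phi'(x)$ (quotient topology) and induced morphisms. $G$-spectra. A $G$-subgroup system is a RIC-domain $\mathfrak S$ where $\mathfrak S_{\mathrm b}$ is a set of subgroups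 of $G$ with the conjugation action and $I\le H$ for $I\in\mathfrak S_\star(H)$. Let $\mathrm{Grp}^2(G)$ be the set of pairs $(H,U)$ with $H$ a closed subgroup of $G$ and $U$ a closed normal subgroup of $H$, ordered componentwise by inclusion, with componentwise conjugation. A two-dimensional $G$-subgroup system is a RIC-domain $\mathfrak E$ with $\mathfrak E_{\mathrm b}\subseteq\mathrm{Grp}^2(G)$ (conjugation action) and $(I,V)\le(H,U)$ for $(I,V)\in\mathfrak E_\star(H,U)$. Put $\mathfrak E^\flat_{\mathrm b}=\{H:(H,U)\in\mathfrak E_{\mathrm b}\text{ for some }U\}$, $\mathrm{Ext}(\mathfrak E,H)=\{U:(H,U)\in\mathfrak E_{\mathrm b}\}$, and let $\mathfrak E^\flat_\star(H)$ be the set of first components of elements of $\bigcup_{U}\mathfrak E_\star(H,U)$. $\mathfrak E$ is regular if $\mathfrak E^\flat=(\mathfrak E^\flat_{\mathrm b},\mathfrak E^\flat_{\mathrm r},\mathfrak E^\flat_{\mathrm i})$ is a $G$-subgroup system. A $G$-spectrum is a regular $\mathfrak E$ such that $(I,V)\in\mathfrak E_{\mathrm r}(H,U)$ implies $V=U$, and $[H:I]<\infty$ whenever $I\in\mathfrak E^\flat_{\mathrm r}(H)$. For $C\in\mathsf{Fct}(\mathfrak E^\flat,\mathcal C)$ let $C^{\mathfrak E}\in\mathsf{Fct}(\mathfrak E,\mathcal C)$ be $C^{\mathfrak E}(H,U)=C(H)$ with the res, ind, con of $C$ on first components. A representation of $\mathfrak E$ is a quotient $C^{\mathfrak E}/\Phi$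 with $C\in\mathsf{Fct}(\mathfrak E^\flat,\mathsf{TAb})$ and $\Phi$ a subfunctor of $C^{\mathfrak E}$; the groups $C(H)$ are written multiplicatively. Transfer. For $I\le H$ closed of finite index with right transversal $T=(t_1,\dots,t_n)$ write $t_ih=\kappa_T(t_ih)t_{\sigma(i)}$ with $\kappa_T(t_ih)\in I$, $\sigma$ a permutation. For $N\lhd I$ with $I/N$ abelian, $\mathrm V^{N}_{I,H}:H\to I/N$, $h\mapsto\prod_i\kappa_T(t_ih)\bmod N$, is a continuous homomorphism independent of $T$. Coabelian classification data. An abelianization system on a $G$-subgroup system $\mathfrak S$ consisting of closed subgroups with $[H:I]<\infty$ for $I\in\mathfrak S_{\mathrm r}(H)$ is a family $\mathrm R(H)\lhd H$ ($H\in\mathfrak S_{\mathrm b}$) of closed normal subgroups with $H/\mathrm R(H)$ abelian, such that $\mathrm R({}^gH)={}^g\mathrm R(H)$, $\mathrm R(H)\subseteq\ker\mathrm V^{\mathrm R(I)}_{I,H}$ for $I\in\mathfrak S_{\mathrm r}(H)$, and $\mathrm R(I)\subseteq\mathrm R(H)$ for $I\in\mathfrak S_{\mathrm i}(H)$. A dualizing functor $D$ on $\mathfrak E^\flat$ is a RIC-functor with values locally compact abelian groups whose res and ind are all isomorphisms. A coabelian classification datum is a triple $\mathfrak K=(\mathfrak E,\mathrm R,D)$: $\mathfrak E$ a $G$-spectrum, $\mathrm R$ an abelianization system on $\mathfrak E^\flat$, $D$ a dualizing functor on $\mathfrak E^\flat$. $\Pi_{\mathfrak K}\in\mathsf{Fct}(\mathfrak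 E,\mathsf{TAb})$ is given by $\Pi_{\mathfrak K}(H,U)=H/U\mathrm R(H)$, with con induced by conjugation, $\mathrm{ind}_{(H,U),(I,V)}$ induced by the inclusion $I\to H$, and $\mathrm{res}_{(I,U),(H,U)}$ induced by $\mathrm V^{U\mathrm R(I)}_{I,H}$. $\mathrm{Hom}(D^{\mathfrak E},\Pi_{\mathfrak K})\in\mathsf{Fct}(\mathfrak E,\mathsf{TAb})$ has values $\mathrm{Hom}_{\mathsf{TAb}}(D(H),\Pi_{\mathfrak K}(H,U))$ (compact-open topology) and each structure map $\mathrm{res}$ (resp. ind, con) is $\chi\mapsto\mathrm{res}^{\Pi_{\mathfrak K}}\circ\chi\circ(\mathrm{res}^{D})^{-1}$ (resp. with ind, con). $\mathrm{Ext}_{\mathrm R}(\mathfrak E,H)=\{U\in\mathrm{Ext}(\mathfrak E,H):U\ge\mathrm R(H)\}$. An $\mathrm R$-lattice $\mathcal L$ in $\mathfrak E$ is a family $\mathcal L(H)\subseteq\mathrm{Ext}_{\mathrm R}(\mathfrak E,H)$ ($H\in\mathfrak E^\flat_{\mathrm b}$), each $\mathcal L(H)$ closed under products and intersections of two members. A $\mathfrak K$-class field theory is an isomorphism $\theta:\mathrm{Hom}(D^{\mathfrak E},\Pi_{\mathfrak K})\to C^{\mathfrak E}/\Phi$ in $\mathsf{Fct}(\mathfrak E,\mathsf{TAb})$ onto a representation such that for every $\mathrm R$-lattice $\mathcal L$ in $\mathfrak E$ and every $H$ the map $\Phi(H,-)|_{\mathcal L(H)}$ is an injective lattice morphism into the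 subgroups of $C(H)$. $\mathfrak K$ is L-coherent if for all $H\in\mathfrak E^\flat_{\mathrm b}$ and all $U_1,U_2\in\mathrm{Ext}_{\mathrm R}(\mathfrak E,H)$ with $U_2\le U_1$: (1) $(H,U_2)\in\mathfrak E_{\mathrm i}(H,U_1)$; (2) if $\mathrm{Hom}_{\mathsf{TAb}}(D(H),U_1/U_2)$ is trivial, then $U_1=U_2$. *)

theory Defs
  imports "HOL-Analysis.Analysis" "HOL-Algebra.Group_Action" "HOL-Algebra.FiniteProduct"
begin

section \<open>Topological groups with explicit carriers\<close>

record 'a topgrp = "'a monoid" +
  topo :: "'a topology"

definition topological_group :: "'a topgrp \<Rightarrow> bool" where
  "topological_group G \<longleftrightarrow>
     group G \<and> topspace (topo G) = carrier G \<and>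
     continuous_map (prod_topology (topo G) (topo G)) (topo G) (\<lambda>(x, y). x \<otimes>\<^bsub>G\<^esub> y) \<and>
     continuous_map (topo G) (topo G) (m_inv G)"

definition TAb :: "'a topgrp \<Rightarrow> bool" where
  "TAb A \<longleftrightarrow> topological_group A \<and> comm_group A"

definition locally_compact_TAb :: "'a topgrp \<Rightarrow> bool" where
  "locally_compact_TAb A \<longleftrightarrow>
     TAb A \<and> Hausdorff_space (topo A) \<and> locally_compact_space (topo A)"

definition TAb_mor :: "'a topgrp \<Rightarrow> 'b topgrp \<Rightarrow> ('a \<Rightarrow> 'b) set" where
  "TAb_mor A B = {f. f \<in> hom A B \<and> continuous_map (topo A) (topo B) f}"

definition TAb_iso :: "'a topgrp \<Rightarrow> 'b topgrp \<Rightarrow> ('a \<Rightarrow> 'b) set" where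
  "TAb_iso A B = {f \<in> TAb_mor A B. \<exists>g \<in> TAb_mor B A.
     (\<forall>x \<in> carrier A. g (f x) = x) \<and> (\<forall>y \<in> carrier B. f (g y) = y)}"

definition subtgrp :: "'a topgrp \<Rightarrow> 'a set \<Rightarrow> 'a topgrp" where
  "subtgrp G H = G\<lparr>carrier := H, topo := subtopology (topo G) H\<rparr>"

definition coset_topology :: "'a topgrp \<Rightarrow> 'a set \<Rightarrow> 'a set topology" where
  "coset_topology A N = topology (\<lambda>W. W \<subseteq> rcosets\<^bsub>A\<^esub> N \<and>
     openin (topo A) {x \<in> carrier A. N #>\<^bsub>A\<^esub> x \<in> W})"

lemma openin_coset_topology:
  "openin (coset_topology A N) W \<longleftrightarrow>
     W \<subseteq> rcosets\<^bsub>A\<^esub> N \<and> openin (topo A) {x \<in> carrier A. N #>\<^bsub>A\<^esub> x \<in> W}"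
proof -
  have "istopology (\<lambda>W. W \<subseteq> rcosets\<^bsub>A\<^esub> N \<and>
     openin (topo A) {x \<in> carrier A. N #>\<^bsub>A\<^esub> x \<in> W})"
    unfolding istopology_def
  proof (intro conjI allI impI)
    fix S T
    assume S: "S \<subseteq> rcosets\<^bsub>A\<^esub> N \<and> openin (topo A) {x \<in> carrier A. N #>\<^bsub>A\<^esub> x \<in> S}"
      and T: "T \<subseteq> rcosets\<^bsub>A\<^esub> N \<and> openin (topo A) {x \<in> carrier A. N #>\<^bsub>A\<^esub> x \<in> T}"
    show "S \<inter> T \<subseteq> rcosets\<^bsub>A\<^esub> N" using S by blast
    have "openin (topo A) ({x \<in> carrier A. N #>\<^bsub>A\<^esub> x \<in> S} \<inter>
        {x \<in> carrier A. N #>\<^bsub>A\<^esub> x \<in> T})"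
      using conjunct2[OF S] conjunct2[OF T] by (rule openin_Int)
    also have "{x \<in> carrier A. N #>\<^bsub>A\<^esub> x \<in> S} \<inter> {x \<in> carrier A. N #>\<^bsub>A\<^esub> x \<in> T} =
        {x \<in> carrier A. N #>\<^bsub>A\<^esub> x \<in> S \<inter> T}" by blast
    finally show "openin (topo A) {x \<in> carrier A. N #>\<^bsub>A\<^esub> x \<in> S \<inter> T}" .
  next
    fix \<K>
    assume K: "\<forall>K\<in>\<K>. K \<subseteq> rcosets\<^bsub>A\<^esub> N \<and> openin (topo A) {x \<in> carrier A. N #>\<^bsub>A\<^esub> x \<in> K}"
    show "\<Union>\<K> \<subseteq> rcosets\<^bsub>A\<^esub> N" using K by blast
    have "openin (topo A) (\<Union>K\<in>\<K>. {x \<in> carrier A. N #>\<^bsub>A\<^esub> x \<in> K})"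
      using K by (intro openin_Union) blast
    also have "(\<Union>K\<in>\<K>. {x \<in> carrier A. N #>\<^bsub>A\<^esub> x \<in> K}) =
        {x \<in> carrier A. N #>\<^bsub>A\<^esub> x \<in> \<Union>\<K>}" by blast
    finally show "openin (topo A) {x \<in> carrier A. N #>\<^bsub>A\<^esub> x \<in> \<Union>\<K>}" .
  qed
  then show ?thesis
    by (simp add: coset_topology_def)
qed

definition tquot :: "'a topgrp \<Rightarrow> 'a set \<Rightarrow> 'a set topgrp" where
  "tquot A N = \<lparr>carrier = carrier (A Mod N), mult = mult (A Mod N), one = one (A Mod N),
                topo = coset_topology A N\<rparr>"

text \<open>If \<open>f\<close> maps \<open>N\<close> into \<open>M\<close>, then \<open>quot_map B M f\<close> is the map \<open>A/N \<rightarrow> B/M\<close> induced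
  by \<open>f : A \<rightarrow> B\<close>: it sends the coset \<open>N x\<close> to \<open>M f(N x) = M f(x)\<close>.\<close>

definition quot_map :: "'b topgrp \<Rightarrow> 'b set \<Rightarrow> ('a \<Rightarrow> 'b) \<Rightarrow> 'a set \<Rightarrow> 'b set" where
  "quot_map B M f = (\<lambda>X. M <#>\<^bsub>B\<^esub> (f ` X))"

text \<open>Elements of the group of continuous homomorphisms are made extensional (\<open>undefined\<close>
  off the carrier), so that equality in this group is equality of maps on the carrier.\<close>

definition hom_carrier :: "'a topgrp \<Rightarrow> 'b topgrp \<Rightarrow> ('a \<Rightarrow> 'b) set" where
  "hom_carrier A B = TAb_mor A B \<inter> extensional (carrier A)"

definition compact_open_topology :: "'a topgrp \<Rightarrow> 'b topgrp \<Rightarrow> ('a \<Rightarrow> 'b) topology" where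
  "compact_open_topology A B = topology_generated_by
     {{f \<in> hom_carrier A B. f ` K \<subseteq> W} | K W. compactin (topo A) K \<and> openin (topo B) W}"

definition TAb_Hom :: "'a topgrp \<Rightarrow> 'b topgrp \<Rightarrow> ('a \<Rightarrow> 'b) topgrp" where
  "TAb_Hom A B =
     \<lparr>carrier = hom_carrier A B,
      mult = (\<lambda>f g. \<lambda>x\<in>carrier A. f x \<otimes>\<^bsub>B\<^esub> g x),
      one = (\<lambda>x\<in>carrier A. \<one>\<^bsub>B\<^esub>),
      topo = compact_open_topology A B\<rparr>"

section \<open>RIC-domains and RIC-functors into topological abelian groups\<close>

record ('g, 'x) ric_domain =
  pts :: "'x set"
  act :: "'g \<Rightarrow> 'x \<Rightarrow> 'x"
  rset :: "'x \<Rightarrow> 'x set"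
  iset :: "'x \<Rightarrow> 'x set"

definition RIC_domain :: "'g topgrp \<Rightarrow> ('g, 'x) ric_domain \<Rightarrow> bool" where
  "RIC_domain G D \<longleftrightarrow>
     pts D \<noteq> {} \<and>
     group_action G (pts D) (\<lambda>g. restrict (act D g) (pts D)) \<and>
     (\<forall>S \<in> {rset D, iset D}. \<forall>x \<in> pts D.
        S x \<subseteq> pts D \<and> x \<in> S x \<and> (\<forall>y \<in> S x. S y \<subseteq> S x) \<and>
        (\<forall>g \<in> carrier G. act D g ` S x = S (act D g x)))"

text \<open>\<open>Fres F y x : F(x) \<rightarrow> F(y)\<close>, \<open>Find F x y : F(y) \<rightarrow> F(x)\<close> and
  \<open>Fcon F g x : F(x) \<rightarrow> F(g x)\<close>; only their values on carriers are relevant.\<close>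

record ('g, 'x, 'a) ric_functor =
  Fobj :: "'x \<Rightarrow> 'a topgrp"
  Fres :: "'x \<Rightarrow> 'x \<Rightarrow> 'a \<Rightarrow> 'a"
  Find :: "'x \<Rightarrow> 'x \<Rightarrow> 'a \<Rightarrow> 'a"
  Fcon :: "'g \<Rightarrow> 'x \<Rightarrow> 'a \<Rightarrow> 'a"

definition RIC_functor ::
  "'g topgrp \<Rightarrow> ('g, 'x) ric_domain \<Rightarrow> ('g, 'x, 'a) ric_functor \<Rightarrow> bool" where
  "RIC_functor G D F \<longleftrightarrow>
     (\<forall>x \<in> pts D. TAb (Fobj F x)) \<and>
     (\<forall>x \<in> pts D. \<forall>y \<in> rset D x. Fres F y x \<in> TAb_mor (Fobj F x) (Fobj F y)) \<and>
     (\<forall>x \<in> pts D. \<forall>y \<in> iset D x. Find F x y \<in> TAb_mor (Fobj F y) (Fobj F x)) \<and>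
     (\<forall>x \<in> pts D. \<forall>g \<in> carrier G. Fcon F g x \<in> TAb_mor (Fobj F x) (Fobj F (act D g x))) \<and>
     (\<forall>x \<in> pts D. \<forall>a \<in> carrier (Fobj F x).
        Fres F x x a = a \<and> Find F x x a = a \<and> Fcon F \<one>\<^bsub>G\<^esub> x a = a) \<and>
     (\<forall>x \<in> pts D. \<forall>y \<in> rset D x. \<forall>z \<in> rset D y. \<forall>a \<in> carrier (Fobj F x).
        Fres F z y (Fres F y x a) = Fres F z x a) \<and>
     (\<forall>x \<in> pts D. \<forall>y \<in> iset D x. \<forall>z \<in> iset D y. \<forall>a \<in> carrier (Fobj F z).
        Find F x y (Find F y z a) = Find F x z a) \<and>
     (\<forall>x \<in> pts D. \<forall>g \<in> carrier G. \<forall>g' \<in> carrier G. \<forall>a \<in> carrier (Fobj F x).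
        Fcon F g' (act D g x) (Fcon F g x a) = Fcon F (g' \<otimes>\<^bsub>G\<^esub> g) x a) \<and>
     (\<forall>x \<in> pts D. \<forall>y \<in> rset D x. \<forall>g \<in> carrier G. \<forall>a \<in> carrier (Fobj F x).
        Fcon F g y (Fres F y x a) = Fres F (act D g y) (act D g x) (Fcon F g x a)) \<and>
     (\<forall>x \<in> pts D. \<forall>y \<in> iset D x. \<forall>g \<in> carrier G. \<forall>a \<in> carrier (Fobj F y).
        Fcon F g x (Find F x y a) = Find F (act D g x) (act D g y) (Fcon F g y a))"

definition RIC_mor ::
  "'g topgrp \<Rightarrow> ('g, 'x) ric_domain \<Rightarrow> ('g, 'x, 'a) ric_functor \<Rightarrow> ('g, 'x, 'b) ric_functor
     \<Rightarrow> ('x \<Rightarrow> 'a \<Rightarrow> 'b) set" where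
  "RIC_mor G D F F' = {\<phi>.
     (\<forall>x \<in> pts D. \<phi> x \<in> TAb_mor (Fobj F x) (Fobj F' x)) \<and>
     (\<forall>x \<in> pts D. \<forall>y \<in> rset D x. \<forall>a \<in> carrier (Fobj F x).
        \<phi> y (Fres F y x a) = Fres F' y x (\<phi> x a)) \<and>
     (\<forall>x \<in> pts D. \<forall>y \<in> iset D x. \<forall>a \<in> carrier (Fobj F y).
        \<phi> x (Find F x y a) = Find F' x y (\<phi> y a)) \<and>
     (\<forall>x \<in> pts D. \<forall>g \<in> carrier G. \<forall>a \<in> carrier (Fobj F x).
        \<phi> (act D g x) (Fcon F g x a) = Fcon F' g x (\<phi> x a))}"

definition RIC_iso ::
  "'g topgrp \<Rightarrow> ('g, 'x) ric_domain \<Rightarrow> ('g, 'x, 'a) ric_functor \<Rightarrow> ('g, 'x, 'b) ric_functor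
     \<Rightarrow> ('x \<Rightarrow> 'a \<Rightarrow> 'b) set" where
  "RIC_iso G D F F' = {\<phi> \<in> RIC_mor G D F F'. \<exists>\<psi> \<in> RIC_mor G D F' F. \<forall>x \<in> pts D.
     (\<forall>a \<in> carrier (Fobj F x). \<psi> x (\<phi> x a) = a) \<and>
     (\<forall>b \<in> carrier (Fobj F' x). \<phi> x (\<psi> x b) = b)}"

definition subfunctor ::
  "'g topgrp \<Rightarrow> ('g, 'x) ric_domain \<Rightarrow> ('g, 'x, 'a) ric_functor \<Rightarrow> ('x \<Rightarrow> 'a set) \<Rightarrow> bool" where
  "subfunctor G D F \<Phi> \<longleftrightarrow>
     (\<forall>x \<in> pts D. subgroup (\<Phi> x) (Fobj F x)) \<and>
     (\<forall>x \<in> pts D. \<forall>y \<in> rset D x. Fres F y x ` \<Phi> x \<subseteq> \<Phi> y) \<and>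
     (\<forall>x \<in> pts D. \<forall>y \<in> iset D x. Find F x y ` \<Phi> y \<subseteq> \<Phi> x) \<and>
     (\<forall>x \<in> pts D. \<forall>g \<in> carrier G. Fcon F g x ` \<Phi> x \<subseteq> \<Phi> (act D g x))"

definition quotient_functor ::
  "('g, 'x) ric_domain \<Rightarrow> ('g, 'x, 'a) ric_functor \<Rightarrow> ('x \<Rightarrow> 'a set)
     \<Rightarrow> ('g, 'x, 'a set) ric_functor" where
  "quotient_functor D F \<Phi> =
     \<lparr>Fobj = (\<lambda>x. tquot (Fobj F x) (\<Phi> x)),
      Fres = (\<lambda>y x. quot_map (Fobj F y) (\<Phi> y) (Fres F y x)),
      Find = (\<lambda>x y. quot_map (Fobj F x) (\<Phi> x) (Find F x y)),
      Fcon = (\<lambda>g x. quot_map (Fobj F (act D g x)) (\<Phi> (act D g x)) (Fcon F g x))\<rparr>"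

text \<open>Pre-composition with the inverse of a structure map of \<open>F\<close> requires that map to be
  bijective between the carriers; \<open>inv_into\<close> is then its inverse.\<close>

definition hom_functor ::
  "('g, 'x) ric_domain \<Rightarrow> ('g, 'x, 'd) ric_functor \<Rightarrow> ('g, 'x, 'p) ric_functor
     \<Rightarrow> ('g, 'x, 'd \<Rightarrow> 'p) ric_functor" where
  "hom_functor D F P =
     \<lparr>Fobj = (\<lambda>x. TAb_Hom (Fobj F x) (Fobj P x)),
      Fres = (\<lambda>y x \<eta>. restrict (Fres P y x \<circ> \<eta> \<circ> inv_into (carrier (Fobj F x)) (Fres F y x))
                (carrier (Fobj F y))),
      Find = (\<lambda>x y \<eta>. restrict (Find P x y \<circ> \<eta> \<circ> inv_into (carrier (Fobj F y)) (Find F x y))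
                (carrier (Fobj F x))),
      Fcon = (\<lambda>g x \<eta>. restrict (Fcon P g x \<circ> \<eta> \<circ> inv_into (carrier (Fobj F x)) (Fcon F g x))
                (carrier (Fobj F (act D g x))))\<rparr>"

section \<open>Subgroup systems and spectra\<close>

definition conj_set :: "'g topgrp \<Rightarrow> 'g \<Rightarrow> 'g set \<Rightarrow> 'g set" where
  "conj_set G g H = (\<lambda>h. g \<otimes>\<^bsub>G\<^esub> h \<otimes>\<^bsub>G\<^esub> inv\<^bsub>G\<^esub> g) ` H"

definition finite_index :: "'g topgrp \<Rightarrow> 'g set \<Rightarrow> 'g set \<Rightarrow> bool" where
  "finite_index G H I \<longleftrightarrow> finite (rcosets\<^bsub>subtgrp G H\<^esub> I)"

definition subgroup_system :: "'g topgrp \<Rightarrow> ('g, 'g set) ric_domain \<Rightarrow> bool" where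
  "subgroup_system G S \<longleftrightarrow>
     RIC_domain G S \<and>
     (\<forall>H \<in> pts S. subgroup H G \<and>
        (\<forall>g \<in> carrier G. act S g H = conj_set G g H) \<and>
        (\<forall>I \<in> rset S H \<union> iset S H. I \<subseteq> H))"

definition Grp2 :: "'g topgrp \<Rightarrow> ('g set \<times> 'g set) set" where
  "Grp2 G = {(H, U). subgroup H G \<and> closedin (topo G) H \<and>
                     U \<lhd> subtgrp G H \<and> closedin (topo G) U}"

type_synonym 'g ric_domain2 = "('g, 'g set \<times> 'g set) ric_domain"

definition subgroup_system2 :: "'g topgrp \<Rightarrow> 'g ric_domain2 \<Rightarrow> bool" where
  "subgroup_system2 G E \<longleftrightarrow>
     RIC_domain G E \<and> pts E \<subseteq> Grp2 G \<and>
     (\<forall>(H, U) \<in> pts E.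
        (\<forall>g \<in> carrier G. act E g (H, U) = (conj_set G g H, conj_set G g U)) \<and>
        (\<forall>(I, V) \<in> rset E (H, U) \<union> iset E (H, U). I \<subseteq> H \<and> V \<subseteq> U))"

definition Ext :: "'g ric_domain2 \<Rightarrow> 'g set \<Rightarrow> 'g set set" where
  "Ext E H = {U. (H, U) \<in> pts E}"

definition flat :: "'g topgrp \<Rightarrow> 'g ric_domain2 \<Rightarrow> ('g, 'g set) ric_domain" where
  "flat G E =
     \<lparr>pts = fst ` pts E,
      act = conj_set G,
      rset = (\<lambda>H. fst ` (\<Union>U \<in> Ext E H. rset E (H, U))),
      iset = (\<lambda>H. fst ` (\<Union>U \<in> Ext E H. iset E (H, U)))\<rparr>"

definition regular_system2 :: "'g topgrp \<Rightarrow> 'g ric_domain2 \<Rightarrow> bool" where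
  "regular_system2 G E \<longleftrightarrow> subgroup_system G (flat G E)"

definition spectrum :: "'g topgrp \<Rightarrow> 'g ric_domain2 \<Rightarrow> bool" where
  "spectrum G E \<longleftrightarrow>
     subgroup_system2 G E \<and> regular_system2 G E \<and>
     (\<forall>(H, U) \<in> pts E. \<forall>(I, V) \<in> rset E (H, U). V = U) \<and>
     (\<forall>H \<in> pts (flat G E). \<forall>I \<in> rset (flat G E) H. finite_index G H I)"

text \<open>The functor written with a spectrum as upper index: a functor on the flattened system,
  evaluated on first components.\<close>

definition inflate ::
  "('g, 'g set, 'a) ric_functor \<Rightarrow> ('g, 'g set \<times> 'g set, 'a) ric_functor" where
  "inflate C =
     \<lparr>Fobj = (\<lambda>x. Fobj C (fst x)),
      Fres = (\<lambda>y x. Fres C (fst y) (fst x)),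
      Find = (\<lambda>x y. Find C (fst x) (fst y)),
      Fcon = (\<lambda>g x. Fcon C g (fst x))\<rparr>"

text \<open>The representation of \<open>E\<close> given by the pair \<open>C, \<Phi>\<close> is the functor
  \<open>quotient_functor E (inflate C) \<Phi>\<close>.\<close>

definition is_representation ::
  "'g topgrp \<Rightarrow> 'g ric_domain2 \<Rightarrow> ('g, 'g set, 'c) ric_functor
     \<Rightarrow> ('g set \<times> 'g set \<Rightarrow> 'c set) \<Rightarrow> bool" where
  "is_representation G E C \<Phi> \<longleftrightarrow>
     RIC_functor G (flat G E) C \<and> subfunctor G E (inflate C) \<Phi>"

section \<open>Transfer\<close>

definition right_transversal :: "'g topgrp \<Rightarrow> 'g set \<Rightarrow> 'g set \<Rightarrow> 'g set \<Rightarrow> bool" where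
  "right_transversal G H I T \<longleftrightarrow> T \<subseteq> H \<and> (\<forall>x \<in> H. \<exists>!t. t \<in> T \<and> x \<in> I #>\<^bsub>G\<^esub> t)"

definition kappa :: "'g topgrp \<Rightarrow> 'g set \<Rightarrow> 'g set \<Rightarrow> 'g \<Rightarrow> 'g" where
  "kappa G I T x = (THE k. k \<in> I \<and> (\<exists>t \<in> T. x = k \<otimes>\<^bsub>G\<^esub> t))"

text \<open>The value does not depend on the transversal, which is therefore chosen arbitrarily.\<close>

definition transfer_map :: "'g topgrp \<Rightarrow> 'g set \<Rightarrow> 'g set \<Rightarrow> 'g set \<Rightarrow> 'g \<Rightarrow> 'g set" where
  "transfer_map G H I N h =
     (let T = (SOME T. right_transversal G H I T)
      in finprod (tquot (subtgrp G I) N) (\<lambda>t. N #>\<^bsub>G\<^esub> kappa G I T (t \<otimes>\<^bsub>G\<^esub> h)) T)"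

section \<open>Coabelian classification data\<close>

definition abelianization_system ::
  "'g topgrp \<Rightarrow> ('g, 'g set) ric_domain \<Rightarrow> ('g set \<Rightarrow> 'g set) \<Rightarrow> bool" where
  "abelianization_system G S R \<longleftrightarrow>
     subgroup_system G S \<and>
     (\<forall>H \<in> pts S. closedin (topo G) H \<and> (\<forall>I \<in> rset S H. finite_index G H I)) \<and>
     (\<forall>H \<in> pts S.
        R H \<lhd> subtgrp G H \<and> closedin (topo G) (R H) \<and>
        comm_group (tquot (subtgrp G H) (R H)) \<and>
        (\<forall>g \<in> carrier G. R (conj_set G g H) = conj_set G g (R H)) \<and>
        (\<forall>I \<in> rset S H.
           R H \<subseteq> kernel (subtgrp G H) (tquot (subtgrp G I) (R I)) (transfer_map G H I (R I))) \<and>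
        (\<forall>I \<in> iset S H. R I \<subseteq> R H))"

definition dualizing_functor ::
  "'g topgrp \<Rightarrow> ('g, 'g set) ric_domain \<Rightarrow> ('g, 'g set, 'd) ric_functor \<Rightarrow> bool" where
  "dualizing_functor G S D \<longleftrightarrow>
     RIC_functor G S D \<and>
     (\<forall>H \<in> pts S. locally_compact_TAb (Fobj D H) \<and>
        (\<forall>I \<in> rset S H. Fres D I H \<in> TAb_iso (Fobj D H) (Fobj D I)) \<and>
        (\<forall>I \<in> iset S H. Find D H I \<in> TAb_iso (Fobj D I) (Fobj D H)))"

definition coabelian_classification_datum ::
  "'g topgrp \<Rightarrow> 'g ric_domain2 \<Rightarrow> ('g set \<Rightarrow> 'g set) \<Rightarrow> ('g, 'g set, 'd) ric_functor \<Rightarrow> bool" where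
  "coabelian_classification_datum G E R D \<longleftrightarrow>
     spectrum G E \<and> abelianization_system G (flat G E) R \<and> dualizing_functor G (flat G E) D"

text \<open>The restriction maps are induced by the transfer, which already takes values in the
  quotient \<open>I / U R(I)\<close> and is constant on the cosets in \<open>H / U R(H)\<close>.\<close>

definition Pi_functor ::
  "'g topgrp \<Rightarrow> ('g set \<Rightarrow> 'g set) \<Rightarrow> ('g, 'g set \<times> 'g set, 'g set) ric_functor" where
  "Pi_functor G R =
     \<lparr>Fobj = (\<lambda>(H, U). tquot (subtgrp G H) (U <#>\<^bsub>G\<^esub> R H)),
      Fres = (\<lambda>(I, U) (H, _). \<lambda>X. the_elem (transfer_map G H I (U <#>\<^bsub>G\<^esub> R I) ` X)),
      Find = (\<lambda>(H, U) (I, V). quot_map (subtgrp G H) (U <#>\<^bsub>G\<^esub> R H) (\<lambda>x. x)),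
      Fcon = (\<lambda>g (H, U). conj_set G g)\<rparr>"

definition Ext_R :: "('g set \<Rightarrow> 'g set) \<Rightarrow> 'g ric_domain2 \<Rightarrow> 'g set \<Rightarrow> 'g set set" where
  "Ext_R R E H = {U \<in> Ext E H. R H \<subseteq> U}"

definition R_lattice ::
  "'g topgrp \<Rightarrow> 'g ric_domain2 \<Rightarrow> ('g set \<Rightarrow> 'g set) \<Rightarrow> ('g set \<Rightarrow> 'g set set) \<Rightarrow> bool" where
  "R_lattice G E R L \<longleftrightarrow>
     (\<forall>H \<in> pts (flat G E). L H \<subseteq> Ext_R R E H \<and>
        (\<forall>U\<^sub>1 \<in> L H. \<forall>U\<^sub>2 \<in> L H. U\<^sub>1 <#>\<^bsub>G\<^esub> U\<^sub>2 \<in> L H \<and> U\<^sub>1 \<inter> U\<^sub>2 \<in> L H))"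

definition class_field_theory ::
  "'g topgrp \<Rightarrow> 'g ric_domain2 \<Rightarrow> ('g set \<Rightarrow> 'g set) \<Rightarrow> ('g, 'g set, 'd) ric_functor
     \<Rightarrow> ('g, 'g set, 'c) ric_functor \<Rightarrow> ('g set \<times> 'g set \<Rightarrow> 'c set)
     \<Rightarrow> ('g set \<times> 'g set \<Rightarrow> ('d \<Rightarrow> 'g set) \<Rightarrow> 'c set) \<Rightarrow> bool" where
  "class_field_theory G E R D C \<Phi> \<theta> \<longleftrightarrow>
     is_representation G E C \<Phi> \<and>
     \<theta> \<in> RIC_iso G E (hom_functor E (inflate D) (Pi_functor G R))
                     (quotient_functor E (inflate C) \<Phi>) \<and>
     (\<forall>L. R_lattice G E R L \<longrightarrow> (\<forall>H \<in> pts (flat G E).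
        (\<forall>U \<in> L H. subgroup (\<Phi> (H, U)) (Fobj C H)) \<and>
        inj_on (\<lambda>U. \<Phi> (H, U)) (L H) \<and>
        (\<forall>U\<^sub>1 \<in> L H. \<forall>U\<^sub>2 \<in> L H.
           \<Phi> (H, U\<^sub>1 <#>\<^bsub>G\<^esub> U\<^sub>2) = \<Phi> (H, U\<^sub>1) <#>\<^bsub>Fobj C H\<^esub> \<Phi> (H, U\<^sub>2) \<and>
           \<Phi> (H, U\<^sub>1 \<inter> U\<^sub>2) = \<Phi> (H, U\<^sub>1) \<inter> \<Phi> (H, U\<^sub>2))))"

definition L_coherent ::
  "'g topgrp \<Rightarrow> 'g ric_domain2 \<Rightarrow> ('g set \<Rightarrow> 'g set) \<Rightarrow> ('g, 'g set, 'd) ric_functor \<Rightarrow> bool" where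
  "L_coherent G E R D \<longleftrightarrow>
     (\<forall>H \<in> pts (flat G E). \<forall>U\<^sub>1 \<in> Ext_R R E H. \<forall>U\<^sub>2 \<in> Ext_R R E H. U\<^sub>2 \<subseteq> U\<^sub>1 \<longrightarrow>
        (H, U\<^sub>2) \<in> iset E (H, U\<^sub>1) \<and>
        (carrier (TAb_Hom (Fobj D H) (tquot (subtgrp G U\<^sub>1) U\<^sub>2))
           = {\<one>\<^bsub>TAb_Hom (Fobj D H) (tquot (subtgrp G U\<^sub>1) U\<^sub>2)\<^esub>} \<longrightarrow> U\<^sub>1 = U\<^sub>2))"

end

theory Submission
  imports Defs
begin

text \<open>For \<open>V \<le> U\<close> in \<open>Ext\<^sub>R(H)\<close>, naturality of \<open>\<theta>\<close> along the induction from \<open>(H, V)\<close> to \<open>(H, U)\<close>,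
  which is the identity on \<open>C(H)\<close> and \<open>D(H)\<close>, yields: if \<open>\<theta>\<close> sends \<open>\<xi> : D(H) \<rightarrow> H/V\<close> to the
  class of \<open>c\<close>, then \<open>c \<in> \<Phi>(H, U)\<close> iff \<open>\<xi>\<close> takes values in \<open>U/V\<close>. Compatibility with
  intersections is then immediate, and injectivity follows from \<open>Hom(D(H), U/V) \<noteq> 0\<close> for
  \<open>V < U\<close>. For products put \<open>V = U\<^sub>1 \<inter> U\<^sub>2\<close>: by compactness \<open>U\<^sub>1U\<^sub>2/V\<close> is the topological direct
  product of \<open>U\<^sub>1/V\<close> and \<open>U\<^sub>2/V\<close>, so a continuous \<open>\<xi>\<close> with values in \<open>U\<^sub>1U\<^sub>2/V\<close> splits into two
  continuous factors.\<close>

section \<open>Subgroups and quotients of topological groups\<close>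

lemma subtgrp_simps [simp]:
  "carrier (subtgrp G H) = H"
  "mult (subtgrp G H) = mult G"
  "one (subtgrp G H) = one G"
  "topo (subtgrp G H) = subtopology (topo G) H"
  by (simp_all add: subtgrp_def)

lemma set_mult_subtgrp [simp]: "U <#>\<^bsub>subtgrp G H\<^esub> V = U <#>\<^bsub>G\<^esub> V"
  by (simp add: set_mult_def)

lemma subtgrp_subtgrp: "U \<subseteq> H \<Longrightarrow> subtgrp (subtgrp G H) U = subtgrp G U"
  by (simp add: subtgrp_def subtopology_subtopology inf.absorb2)

lemma topological_group_subtgrp:
  assumes G: "topological_group G" and H: "subgroup H G"
  shows "topological_group (subtgrp G H)"
proof -
  have grp: "group G" and tc: "topspace (topo G) = carrier G"
    and mc: "continuous_map (prod_topology (topo G) (topo G)) (topo G) (\<lambda>(x, y). x \<otimes>\<^bsub>G\<^esub> y)"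
    and ic: "continuous_map (topo G) (topo G) (m_inv G)"
    using G by (auto simp: topological_group_def)
  interpret group G by (rule grp)
  interpret H: subgroup H G by (rule H)
  have gH: "group (subtgrp G H)"
  proof (rule groupI)
    show "\<exists>y\<in>carrier (subtgrp G H). y \<otimes>\<^bsub>subtgrp G H\<^esub> x = \<one>\<^bsub>subtgrp G H\<^esub>"
      if "x \<in> carrier (subtgrp G H)" for x
      using that by (intro bexI[of _ "m_inv G x"]) auto
  qed (auto simp: m_assoc)
  have inv_eq: "m_inv (subtgrp G H) x = m_inv G x" if "x \<in> H" for x
    by (rule group.inv_equality[OF gH]) (use that in auto)
  have ts: "topspace (subtopology (topo G) H) = H"
    using tc H.subset by auto
  have "continuous_map (subtopology (topo G) H) (subtopology (topo G) H) (m_inv (subtgrp G H))"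
  proof (rule continuous_map_eq)
    show "continuous_map (subtopology (topo G) H) (subtopology (topo G) H) (m_inv G)"
      using ic ts by (auto simp: continuous_map_in_subtopology
          continuous_map_from_subtopology)
  qed (use ts inv_eq in auto)
  moreover have "continuous_map
      (prod_topology (subtopology (topo G) H) (subtopology (topo G) H)) (subtopology (topo G) H)
      (\<lambda>(x, y). x \<otimes>\<^bsub>G\<^esub> y)"
    using mc ts
    by (auto simp: continuous_map_in_subtopology prod_topology_subtopology
         continuous_map_from_subtopology)
  ultimately show ?thesis
    using gH ts by (simp add: topological_group_def)
qed

lemma tquot_simps [simp]:
  "carrier (tquot P N) = rcosets\<^bsub>P\<^esub> N"
  "mult (tquot P N) = set_mult P"
  "one (tquot P N) = N"
  "topo (tquot P N) = coset_topology P N"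
  by (simp_all add: tquot_def FactGroup_def fun_eq_iff)

lemma topspace_coset_topology:
  assumes "topological_group P" "N \<subseteq> carrier P"
  shows "topspace (coset_topology P N) = rcosets\<^bsub>P\<^esub> N"
proof
  show "topspace (coset_topology P N) \<subseteq> rcosets\<^bsub>P\<^esub> N"
    using openin_topspace[of "coset_topology P N"] unfolding openin_coset_topology by blast
  have "{x \<in> carrier P. N #>\<^bsub>P\<^esub> x \<in> rcosets\<^bsub>P\<^esub> N} = topspace (topo P)"
    using assms by (auto simp: topological_group_def RCOSETS_def)
  then have "openin (coset_topology P N) (rcosets\<^bsub>P\<^esub> N)"
    unfolding openin_coset_topology by simp
  then show "rcosets\<^bsub>P\<^esub> N \<subseteq> topspace (coset_topology P N)"
    by (rule openin_subset)
qed

text \<open>Continuity of a factor is later tested on closed sets, because products of closed sets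
  are closed in a compact group; this is the matching description of closed sets in a
  quotient.\<close>

lemma closedin_coset_topology:
  assumes "topological_group P" "N \<subseteq> carrier P"
  shows "closedin (coset_topology P N) F \<longleftrightarrow>
     F \<subseteq> rcosets\<^bsub>P\<^esub> N \<and> closedin (topo P) {x \<in> carrier P. N #>\<^bsub>P\<^esub> x \<in> F}"
proof -
  have tc: "topspace (topo P) = carrier P"
    using assms by (simp add: topological_group_def)
  have "{x \<in> carrier P. N #>\<^bsub>P\<^esub> x \<in> rcosets\<^bsub>P\<^esub> N - F} =
      carrier P - {x \<in> carrier P. N #>\<^bsub>P\<^esub> x \<in> F}"
    by (auto simp: RCOSETS_def)
  then show ?thesis
    by (auto simp: closedin_def openin_coset_topology topspace_coset_topology[OF assms] tc)
qed

text \<open>In a compact Hausdorff group \<open>S\<close> and \<open>T\<close> are compact, hence so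
  is the image of \<open>S \<times> T\<close> under the continuous multiplication, and compact sets
  are closed.\<close>

lemma closedin_set_mult:
  assumes P: "topological_group P" "compact_space (topo P)" "Hausdorff_space (topo P)"
    and S: "closedin (topo P) S" and T: "closedin (topo P) T"
  shows "closedin (topo P) (S <#>\<^bsub>P\<^esub> T)"
proof -
  have "compactin (prod_topology (topo P) (topo P)) (S \<times> T)"
    using P S T by (simp add: compactin_Times closedin_compact_space)
  moreover have "continuous_map (prod_topology (topo P) (topo P)) (topo P)
      (\<lambda>(x, y). x \<otimes>\<^bsub>P\<^esub> y)"
    using P by (simp add: topological_group_def)
  ultimately have "compactin (topo P) ((\<lambda>(x, y). x \<otimes>\<^bsub>P\<^esub> y) ` (S \<times> T))"
    by (rule image_compactin)
  moreover have "(\<lambda>(x, y). x \<otimes>\<^bsub>P\<^esub> y) ` (S \<times> T) = S <#>\<^bsub>P\<^esub> T"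
    by (auto simp: set_mult_def)
  ultimately show ?thesis
    using P compactin_imp_closedin by fastforce
qed

section \<open>Coset arithmetic and continuity of one factor\<close>

lemma (in group) rcos_eq_iff:
  assumes "subgroup N G" "x \<in> carrier G" "y \<in> carrier G"
  shows "N #> x = N #> y \<longleftrightarrow> x \<in> N #> y"
  using assms repr_independence rcos_self by blast

lemma (in group) subset_set_mult:
  assumes N: "subgroup N G" and M: "subgroup M G"
  shows "N \<subseteq> N <#> M" and "M \<subseteq> N <#> M"
proof -
  interpret N: subgroup N G by (rule N)
  interpret M: subgroup M G by (rule M)
  have "x \<otimes> \<one> \<in> N <#> M" if "x \<in> N" for x
    using that M.one_closed unfolding set_mult_def by blast
  then show "N \<subseteq> N <#> M" by auto
  have "\<one> \<otimes> x \<in> N <#> M" if "x \<in> M" for x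
    using that N.one_closed unfolding set_mult_def by blast
  then show "M \<subseteq> N <#> M" by auto
qed

text \<open>The product \<open>M <#> N\<close> collapses to \<open>M\<close>. Left multiplication by
  \<open>M\<close> is thereby the canonical projection from cosets of \<open>N\<close> to cosets of
  \<open>M\<close>, the form in which \<open>quot_map\<close> of the identity produces it.\<close>

lemma (in group) set_mult_rcos_absorb:
  assumes N: "subgroup N G" and M: "subgroup M G" and "N \<subseteq> M" "x \<in> carrier G"
  shows "M <#> (N #> x) = M #> x"
proof -
  have "M <#> N = M"
  proof
    show "M <#> N \<subseteq> M"
      using \<open>N \<subseteq> M\<close> subgroup.m_closed[OF M] by (auto simp: set_mult_def)
    show "M \<subseteq> M <#> N"
      by (rule subset_set_mult(1)[OF M N])
  qed
  then show ?thesis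
    using assms by (simp add: setmult_rcos_assoc subgroup.subset)
qed

text \<open>The first factor of \<open>u d \<otimes> w d\<close> depends continuously on the product: the preimage of a
  closed set is described by a product of compact sets, hence closed.\<close>

lemma continuous_map_coset_component:
  assumes P: "topological_group P" "compact_space (topo P)" "Hausdorff_space (topo P)"
    and U1: "subgroup U1 P" "closedin (topo P) U1"
    and U2: "subgroup U2 P" "closedin (topo P) U2"
    and V: "V = U1 \<inter> U2" "V \<lhd> P"
    and u: "\<And>d. d \<in> topspace X \<Longrightarrow> u d \<in> U1" and w: "\<And>d. d \<in> topspace X \<Longrightarrow> w d \<in> U2"
    and cont: "continuous_map X (coset_topology P V) (\<lambda>d. V #>\<^bsub>P\<^esub> (u d \<otimes>\<^bsub>P\<^esub> w d))"
  shows "continuous_map X (coset_topology P V) (\<lambda>d. V #>\<^bsub>P\<^esub> u d)"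
proof -
  interpret group P using P by (simp add: topological_group_def)
  interpret U1: subgroup U1 P by (rule U1)
  interpret U2: subgroup U2 P by (rule U2)
  interpret V: normal V P by (rule V)
  have Vsub: "V \<subseteq> carrier P" by (rule V.subset)
  have sV: "subgroup V P" by (rule V.subgroup_axioms)
  note top = topspace_coset_topology[OF P(1) Vsub]
  note clo = closedin_coset_topology[OF P(1) Vsub]
  show ?thesis
    unfolding continuous_map_closedin top
  proof (intro conjI ballI allI impI)
    show "(\<lambda>d. V #>\<^bsub>P\<^esub> u d) \<in> topspace X \<rightarrow> rcosets\<^bsub>P\<^esub> V"
      using rcosetsI[OF Vsub] u by auto
  next
    fix F assume F: "closedin (coset_topology P V) F"
    \<comment> \<open>\<open>S\<close> collects the products of an element of \<open>U1\<close>
      whose coset lies in \<open>F\<close> with any element of \<open>U2\<close>, and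
      \<open>F'\<close> is its image modulo \<open>V\<close>. The aim is that the coset of
      \<open>u d \<otimes> w d\<close> lies in \<open>F'\<close> exactly when that of
      \<open>u d\<close> lies in \<open>F\<close>.\<close>
    define F1 where "F1 = {x \<in> carrier P. V #>\<^bsub>P\<^esub> x \<in> F} \<inter> U1"
    define S where "S = F1 <#>\<^bsub>P\<^esub> U2"
    define F' where "F' = (\<lambda>x. V #>\<^bsub>P\<^esub> x) ` S"
    have F1c: "closedin (topo P) F1"
      using F U1 unfolding F1_def clo by (intro closedin_Int) auto
    have Sc: "closedin (topo P) S"
      unfolding S_def using P F1c U2 by (intro closedin_set_mult) auto
    have Ssub: "S \<subseteq> carrier P"
      by (auto simp: S_def F1_def set_mult_def)
    \<comment> \<open>\<open>S\<close> is a union of cosets of \<open>V\<close>: since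
      \<open>V\<close> lies in \<open>U1\<close>, the set \<open>F1\<close> is stable under left
      multiplication by \<open>V\<close>. Hence \<open>S\<close> is the full preimage of
      \<open>F'\<close>.\<close>
    have memS: "x \<in> S" if x: "x \<in> carrier P" and xF: "V #>\<^bsub>P\<^esub> x \<in> F'" for x
    proof -
      obtain s where s: "s \<in> S" "V #>\<^bsub>P\<^esub> x = V #>\<^bsub>P\<^esub> s"
        using xF by (auto simp: F'_def)
      then have "x \<in> V #>\<^bsub>P\<^esub> s"
        using rcos_eq_iff[OF sV x] Ssub by auto
      then obtain v where v: "v \<in> V" "x = v \<otimes>\<^bsub>P\<^esub> s" by (auto simp: r_coset_def)
      obtain f y where f: "f \<in> F1" "y \<in> U2" "s = f \<otimes>\<^bsub>P\<^esub> y"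
        using s by (auto simp: S_def set_mult_def)
      have fc: "f \<in> carrier P" using f by (auto simp: F1_def)
      have "V #>\<^bsub>P\<^esub> (v \<otimes>\<^bsub>P\<^esub> f) = V #>\<^bsub>P\<^esub> f"
        using v fc Vsub by (metis V.mem_carrier coset_join2 coset_mult_assoc sV)
      then have "v \<otimes>\<^bsub>P\<^esub> f \<in> F1"
        using f v V by (auto simp: F1_def)
      moreover have "x = (v \<otimes>\<^bsub>P\<^esub> f) \<otimes>\<^bsub>P\<^esub> y"
        using v f fc by (simp add: m_assoc)
      ultimately show ?thesis using f by (auto simp: S_def set_mult_def)
    qed
    have "{x \<in> carrier P. V #>\<^bsub>P\<^esub> x \<in> F'} = S"
      using memS Ssub by (auto simp: F'_def)
    then have "closedin (coset_topology P V) F'"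
      using Sc Ssub unfolding clo by (auto simp: F'_def RCOSETS_def)
    then have "closedin X {d \<in> topspace X. V #>\<^bsub>P\<^esub> (u d \<otimes>\<^bsub>P\<^esub> w d) \<in> F'}"
      using cont unfolding continuous_map_closedin by blast
    moreover have "V #>\<^bsub>P\<^esub> (u d \<otimes>\<^bsub>P\<^esub> w d) \<in> F' \<longleftrightarrow> V #>\<^bsub>P\<^esub> u d \<in> F"
      if d: "d \<in> topspace X" for d
    proof
      assume "V #>\<^bsub>P\<^esub> u d \<in> F"
      then have "u d \<otimes>\<^bsub>P\<^esub> w d \<in> S"
        using u[OF d] w[OF d] by (auto simp: S_def F1_def set_mult_def)
      then show "V #>\<^bsub>P\<^esub> (u d \<otimes>\<^bsub>P\<^esub> w d) \<in> F'" by (auto simp: F'_def)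
    next
      assume "V #>\<^bsub>P\<^esub> (u d \<otimes>\<^bsub>P\<^esub> w d) \<in> F'"
      then have "u d \<otimes>\<^bsub>P\<^esub> w d \<in> S"
        using u[OF d] w[OF d] by (intro memS) auto
      then obtain f y where f: "f \<in> F1" "y \<in> U2" "u d \<otimes>\<^bsub>P\<^esub> w d = f \<otimes>\<^bsub>P\<^esub> y"
        by (auto simp: S_def set_mult_def)
      have fc: "f \<in> U1" "f \<in> carrier P" using f by (auto simp: F1_def)
      have udc: "u d \<in> carrier P" and wdc: "w d \<in> carrier P" and yc: "y \<in> carrier P"
        using u[OF d] w[OF d] f by auto
      \<comment> \<open>\<open>z\<close> compares the first factors of the two factorizations
        \<open>u d \<otimes> w d = f \<otimes> y\<close>. It lies in \<open>U1\<close> by definition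
        and equals \<open>y \<otimes> inv w d\<close>, so it lies in \<open>U2\<close> as well,
        hence in \<open>V\<close>. Normality of \<open>V\<close> then turns the left coset of
        \<open>f\<close> into the right one.\<close>
      define z where "z = inv\<^bsub>P\<^esub> f \<otimes>\<^bsub>P\<^esub> u d"
      have zc: "z \<in> carrier P" using fc udc by (simp add: z_def)
      have uz: "u d = f \<otimes>\<^bsub>P\<^esub> z"
        using fc udc by (simp add: z_def m_assoc[symmetric])
      have "f \<otimes>\<^bsub>P\<^esub> (z \<otimes>\<^bsub>P\<^esub> w d) = f \<otimes>\<^bsub>P\<^esub> y"
        using f(3) uz fc zc wdc by (simp add: m_assoc)
      then have "z \<otimes>\<^bsub>P\<^esub> w d = y" using fc zc wdc yc by simp
      then have "z = y \<otimes>\<^bsub>P\<^esub> inv\<^bsub>P\<^esub> w d"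
        using zc wdc yc inv_solve_right by metis
      then have "z \<in> U2" using f w[OF d] by simp
      moreover have "z \<in> U1" unfolding z_def using fc u[OF d] by blast
      ultimately have "z \<in> V" using V by simp
      then have "u d \<in> f <#\<^bsub>P\<^esub> V" using uz by (auto simp: l_coset_def)
      then have "u d \<in> V #>\<^bsub>P\<^esub> f" using V.coset_eq fc by auto
      then have "V #>\<^bsub>P\<^esub> u d = V #>\<^bsub>P\<^esub> f" using rcos_eq_iff[OF sV udc fc(2)] by simp
      then show "V #>\<^bsub>P\<^esub> u d \<in> F" using f by (auto simp: F1_def)
    qed
    ultimately show "closedin X {d \<in> topspace X. V #>\<^bsub>P\<^esub> u d \<in> F}"
      by (smt (verit) Collect_cong)
  qed
qed

text \<open>As \<open>M <#> X\<close> is the projection of \<open>X\<close> to cosets of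
  \<open>M\<close>, both sides say that this projection is trivial. Triviality of a pushed forward
  homomorphism thus becomes a bound on its values.\<close>

lemma (in group) set_mult_rcos_eq_iff:
  assumes "subgroup N G" "subgroup M G" "N \<subseteq> M" "X \<in> rcosets N"
  shows "M <#> X = M \<longleftrightarrow> X \<subseteq> M"
proof -
  obtain x where x: "x \<in> carrier G" "X = N #> x" using assms by (auto simp: RCOSETS_def)
  have e: "M <#> X = M #> x" using x assms set_mult_rcos_absorb by simp
  have "X \<subseteq> M \<longleftrightarrow> x \<in> M"
  proof
    assume "X \<subseteq> M" then show "x \<in> M" using x rcos_self[OF x(1) assms(1)] by auto
  next
    assume "x \<in> M"
    then show "X \<subseteq> M" using x assms subgroup.m_closed[OF assms(2)] by (auto simp: r_coset_def)
  qed
  then show ?thesis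
    using e x assms by (metis coset_join1 coset_join2 subgroup.subset)
qed

section \<open>The classification over one fixed group \<open>H\<close>\<close>

text \<open>\<open>P\<close> stands for H, \<open>K\<close> for C(H), \<open>A\<close> for D(H),
  \<open>\<S>\<close> for \<open>Ext_R R E H\<close>, and \<Phi>, \<theta> are evaluated at the
  pairs (H, U). The inductions between such pairs act as the identity on C(H) and D(H), so stability
  of \<Phi> becomes \<open>\<Phi>_mono\<close> and naturality of \<theta> becomes
  \<open>\<theta>_natural\<close>. \<open>S_comm\<close> expresses that H/U is abelian, as U
  contains R(H).\<close>

locale coset_classification = P: group P + K: comm_group K
  for P :: "'g topgrp" and K :: "'c topgrp" +
  fixes A :: "'d topgrp"
    and \<S> :: "'g set set"
    and \<Phi> :: "'g set \<Rightarrow> 'c set"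
    and \<theta> :: "'g set \<Rightarrow> ('d \<Rightarrow> 'g set) \<Rightarrow> 'c set"
  assumes P: "topological_group P" "compact_space (topo P)" "Hausdorff_space (topo P)"
    and A: "topological_group A"
    and S_normal: "U \<in> \<S> \<Longrightarrow> U \<lhd> P"
    and S_closed: "U \<in> \<S> \<Longrightarrow> closedin (topo P) U"
    and S_comm: "\<lbrakk>U \<in> \<S>; x \<in> carrier P; y \<in> carrier P\<rbrakk> \<Longrightarrow>
      U #>\<^bsub>P\<^esub> (x \<otimes>\<^bsub>P\<^esub> y) = U #>\<^bsub>P\<^esub> (y \<otimes>\<^bsub>P\<^esub> x)"
    and \<Phi>_subgroup: "U \<in> \<S> \<Longrightarrow> subgroup (\<Phi> U) K"
    and \<Phi>_mono: "\<lbrakk>U \<in> \<S>; V \<in> \<S>; V \<subseteq> U\<rbrakk> \<Longrightarrow> \<Phi> V \<subseteq> \<Phi> U"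
    and \<theta>_hom: "U \<in> \<S> \<Longrightarrow> \<theta> U \<in> hom (TAb_Hom A (tquot P U)) (tquot K (\<Phi> U))"
    and \<theta>_bij: "U \<in> \<S> \<Longrightarrow> bij_betw (\<theta> U) (hom_carrier A (tquot P U)) (rcosets\<^bsub>K\<^esub> \<Phi> U)"
    and \<theta>_natural: "\<lbrakk>U \<in> \<S>; V \<in> \<S>; V \<subseteq> U; \<xi> \<in> hom_carrier A (tquot P V)\<rbrakk> \<Longrightarrow>
      \<theta> U (\<lambda>d\<in>carrier A. U <#>\<^bsub>P\<^esub> \<xi> d) = \<Phi> U <#>\<^bsub>K\<^esub> \<theta> V \<xi>"
begin

lemma S_subgroup: "U \<in> \<S> \<Longrightarrow> subgroup U P"
  using S_normal normal_imp_subgroup by blast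

lemma A_topspace: "topspace (topo A) = carrier A"
  using A by (simp add: topological_group_def)

lemma S_topspace: "U \<in> \<S> \<Longrightarrow> topspace (coset_topology P U) = rcosets\<^bsub>P\<^esub> U"
  using topspace_coset_topology P S_subgroup subgroup.subset by metis

lemma hom_carrierI:
  assumes U: "U \<in> \<S>"
    and c: "continuous_map (topo A) (coset_topology P U) \<xi>"
    and m: "\<And>x y. \<lbrakk>x \<in> carrier A; y \<in> carrier A\<rbrakk> \<Longrightarrow> \<xi> (x \<otimes>\<^bsub>A\<^esub> y) = \<xi> x <#>\<^bsub>P\<^esub> \<xi> y"
  shows "restrict \<xi> (carrier A) \<in> hom_carrier A (tquot P U)"
proof -
  interpret A: group A using A by (simp add: topological_group_def)
  have "\<xi> x \<in> rcosets\<^bsub>P\<^esub> U" if "x \<in> carrier A" for x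
    using c that S_topspace[OF U] A_topspace by (auto simp: continuous_map_def)
  moreover have "continuous_map (topo A) (coset_topology P U) (restrict \<xi> (carrier A))"
    using c by (rule continuous_map_eq) (simp add: A_topspace)
  ultimately show ?thesis
    using m by (auto simp: hom_carrier_def TAb_mor_def hom_def)
qed

lemma hom_carrier_coset:
  "\<lbrakk>\<xi> \<in> hom_carrier A (tquot P U); d \<in> carrier A\<rbrakk> \<Longrightarrow> \<xi> d \<in> rcosets\<^bsub>P\<^esub> U"
  by (auto simp: hom_carrier_def TAb_mor_def hom_def)

lemma rcos_mult: "\<lbrakk>U \<in> \<S>; x \<in> carrier P; y \<in> carrier P\<rbrakk> \<Longrightarrow>
    (U #>\<^bsub>P\<^esub> x) <#>\<^bsub>P\<^esub> (U #>\<^bsub>P\<^esub> y) = U #>\<^bsub>P\<^esub> (x \<otimes>\<^bsub>P\<^esub> y)"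
  using normal.rcos_sum[OF S_normal] by blast

text \<open>This is composition with the continuous projection P/V to P/U. Membership is required
  before injectivity of \<open>\<theta> U\<close> can be applied to the pushforward.\<close>

lemma pushforward_mem_hom_carrier:
  assumes U: "U \<in> \<S>" and V: "V \<in> \<S>" and VU: "V \<subseteq> U"
    and \<xi>: "\<xi> \<in> hom_carrier A (tquot P V)"
  shows "(\<lambda>d\<in>carrier A. U <#>\<^bsub>P\<^esub> \<xi> d) \<in> hom_carrier A (tquot P U)"
proof (rule hom_carrierI[OF U])
  note sU = S_subgroup[OF U] and sV = S_subgroup[OF V]
  note absorb = P.set_mult_rcos_absorb[OF sV sU VU]
  have rep: "\<exists>x\<in>carrier P. \<xi> d = V #>\<^bsub>P\<^esub> x" if "d \<in> carrier A" for d
    using hom_carrier_coset[OF \<xi> that] by (auto simp: RCOSETS_def)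
  show "continuous_map (topo A) (coset_topology P U) (\<lambda>d. U <#>\<^bsub>P\<^esub> \<xi> d)"
    unfolding continuous_map_def S_topspace[OF U] A_topspace
  proof (intro conjI allI impI)
    show "(\<lambda>d. U <#>\<^bsub>P\<^esub> \<xi> d) \<in> carrier A \<rightarrow> rcosets\<^bsub>P\<^esub> U"
    proof
      fix d assume "d \<in> carrier A"
      then obtain x where "x \<in> carrier P" "\<xi> d = V #>\<^bsub>P\<^esub> x" using rep by blast
      then show "U <#>\<^bsub>P\<^esub> \<xi> d \<in> rcosets\<^bsub>P\<^esub> U"
        using absorb P.rcosetsI[OF subgroup.subset[OF sU]] by simp
    qed
    fix W assume W: "openin (coset_topology P U) W"
    \<comment> \<open>The preimage of \<open>W\<close> under the projection P/V to P/U. Openness in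
      either quotient is decided by the preimage in \<open>P\<close>, and the preimages of
      \<open>W'\<close> and \<open>W\<close> there coincide.\<close>
    define W' where "W' = {X \<in> rcosets\<^bsub>P\<^esub> V. U <#>\<^bsub>P\<^esub> X \<in> W}"
    have "{x \<in> carrier P. V #>\<^bsub>P\<^esub> x \<in> W'} = {x \<in> carrier P. U #>\<^bsub>P\<^esub> x \<in> W}"
      using absorb P.rcosetsI[OF subgroup.subset[OF sV]] by (auto simp: W'_def)
    then have "openin (coset_topology P V) W'"
      using W unfolding openin_coset_topology by (simp add: W'_def)
    moreover have "continuous_map (topo A) (coset_topology P V) \<xi>"
      using \<xi> by (simp add: hom_carrier_def TAb_mor_def)
    ultimately have "openin (topo A) {d \<in> carrier A. \<xi> d \<in> W'}"
      unfolding continuous_map_def A_topspace by blast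
    moreover have "{d \<in> carrier A. \<xi> d \<in> W'} = {d \<in> carrier A. U <#>\<^bsub>P\<^esub> \<xi> d \<in> W}"
      using hom_carrier_coset[OF \<xi>] by (auto simp: W'_def)
    ultimately show "openin (topo A) {d \<in> carrier A. U <#>\<^bsub>P\<^esub> \<xi> d \<in> W}" by simp
  qed
  fix d e assume d: "d \<in> carrier A" and e: "e \<in> carrier A"
  obtain x where x: "x \<in> carrier P" "\<xi> d = V #>\<^bsub>P\<^esub> x" using rep[OF d] by blast
  obtain y where y: "y \<in> carrier P" "\<xi> e = V #>\<^bsub>P\<^esub> y" using rep[OF e] by blast
  have "\<xi> (d \<otimes>\<^bsub>A\<^esub> e) = \<xi> d <#>\<^bsub>P\<^esub> \<xi> e"
    using \<xi> d e by (simp add: hom_carrier_def TAb_mor_def hom_def)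
  then show "U <#>\<^bsub>P\<^esub> \<xi> (d \<otimes>\<^bsub>A\<^esub> e) = (U <#>\<^bsub>P\<^esub> \<xi> d) <#>\<^bsub>P\<^esub> (U <#>\<^bsub>P\<^esub> \<xi> e)"
    using x y by (simp add: rcos_mult[OF U] rcos_mult[OF V] absorb)
qed

lemma trivial_mem_hom_carrier:
  assumes "U \<in> \<S>"
  shows "(\<lambda>d\<in>carrier A. U) \<in> hom_carrier A (tquot P U)"
proof (rule hom_carrierI[OF assms])
  have "U \<in> rcosets\<^bsub>P\<^esub> U"
    using subgroup.subgroup_in_rcosets[OF S_subgroup[OF assms] P.is_group] .
  then show "continuous_map (topo A) (coset_topology P U) (\<lambda>d. U)"
    using S_topspace[OF assms] by simp
qed (use P.subgroup_mult_id[OF S_subgroup[OF assms]] in auto)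

lemma \<theta>_mult:
  assumes "U \<in> \<S>" "\<xi> \<in> hom_carrier A (tquot P U)" "\<eta> \<in> hom_carrier A (tquot P U)"
  shows "\<theta> U (\<lambda>d\<in>carrier A. \<xi> d <#>\<^bsub>P\<^esub> \<eta> d) = \<theta> U \<xi> <#>\<^bsub>K\<^esub> \<theta> U \<eta>"
  using \<theta>_hom[OF assms(1)] assms by (simp add: hom_def TAb_Hom_def)

text \<open>The trivial homomorphism is idempotent under pointwise multiplication, so its image is
  idempotent too, and the only idempotent of the factor group of \<open>K\<close> by
  \<open>\<Phi> U\<close> is its identity \<open>\<Phi> U\<close>.\<close>

lemma \<theta>_trivial:
  assumes U: "U \<in> \<S>"
  shows "\<theta> U (\<lambda>d\<in>carrier A. U) = \<Phi> U"
proof -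
  let ?e = "\<lambda>d\<in>carrier A. U"
  interpret \<Phi>: normal "\<Phi> U" K
    using K.subgroup_imp_normal \<Phi>_subgroup[OF U] by blast
  interpret Q: group "K Mod \<Phi> U" by (rule \<Phi>.factorgroup_is_group)
  have "(\<lambda>d\<in>carrier A. ?e d <#>\<^bsub>P\<^esub> ?e d) = ?e"
    using P.subgroup_mult_id[OF S_subgroup[OF U]] by (simp add: restrict_def cong: if_cong)
  then have "\<theta> U ?e <#>\<^bsub>K\<^esub> \<theta> U ?e = \<theta> U ?e"
    using \<theta>_mult[OF U trivial_mem_hom_carrier[OF U] trivial_mem_hom_carrier[OF U]] by simp
  moreover have "\<theta> U ?e \<in> rcosets\<^bsub>K\<^esub> \<Phi> U"
    using \<theta>_bij[OF U] trivial_mem_hom_carrier[OF U] by (auto simp: bij_betw_def)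
  ultimately show ?thesis
    using Q.l_cancel_one[of "\<theta> U ?e" "\<theta> U ?e"] by (simp add: FactGroup_def)
qed

text \<open>By naturality the pushforward of \<xi> to P/U is sent to the coset of \<open>c\<close>.
  Injectivity of \<open>\<theta> U\<close> makes this coset trivial exactly when the pushforward is
  trivial. All lattice properties are read off from this criterion.\<close>

lemma mem_\<Phi>_iff:
  assumes U: "U \<in> \<S>" and V: "V \<in> \<S>" and VU: "V \<subseteq> U"
    and \<xi>: "\<xi> \<in> hom_carrier A (tquot P V)"
    and c: "c \<in> carrier K" "\<theta> V \<xi> = \<Phi> V #>\<^bsub>K\<^esub> c"
  shows "c \<in> \<Phi> U \<longleftrightarrow> (\<forall>d\<in>carrier A. \<xi> d \<subseteq> U)"
proof -
  let ?\<xi>U = "\<lambda>d\<in>carrier A. U <#>\<^bsub>P\<^esub> \<xi> d"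
  have nat: "?\<xi>U \<in> hom_carrier A (tquot P U)" "\<theta> U ?\<xi>U = \<Phi> U #>\<^bsub>K\<^esub> c"
    using pushforward_mem_hom_carrier[OF U V VU \<xi>] \<theta>_natural[OF U V VU \<xi>] c \<Phi>_subgroup[OF U] \<Phi>_subgroup[OF V] \<Phi>_mono[OF U V VU]
    by (simp_all add: K.set_mult_rcos_absorb)
  have "c \<in> \<Phi> U \<longleftrightarrow> \<theta> U ?\<xi>U = \<theta> U (\<lambda>d\<in>carrier A. U)"
    using nat \<theta>_trivial[OF U] c \<Phi>_subgroup[OF U]
    by (metis K.coset_join1 K.coset_join2 subgroup.subset)
  also have "\<dots> \<longleftrightarrow> ?\<xi>U = (\<lambda>d\<in>carrier A. U)"
    by (rule inj_on_eq_iff[OF bij_betw_imp_inj_on[OF \<theta>_bij[OF U]] nat(1) trivial_mem_hom_carrier[OF U]])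
  also have "\<dots> \<longleftrightarrow> (\<forall>d\<in>carrier A. U <#>\<^bsub>P\<^esub> \<xi> d = U)"
    by (auto simp: restrict_def fun_eq_iff)
  also have "\<dots> \<longleftrightarrow> (\<forall>d\<in>carrier A. \<xi> d \<subseteq> U)"
    using P.set_mult_rcos_eq_iff[OF S_subgroup[OF V] S_subgroup[OF U] VU]
      hom_carrier_coset[OF \<xi>] by simp
  finally show ?thesis .
qed

section \<open>Behaviour of \<Phi> on intersections and products\<close>

lemma \<theta>_preimage:
  assumes "U \<in> \<S>" "c \<in> carrier K"
  obtains \<xi> where "\<xi> \<in> hom_carrier A (tquot P U)" "\<theta> U \<xi> = \<Phi> U #>\<^bsub>K\<^esub> c"
proof -
  have "\<Phi> U #>\<^bsub>K\<^esub> c \<in> \<theta> U ` hom_carrier A (tquot P U)"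
    using \<theta>_bij[OF assms(1)] assms(2) by (auto simp: bij_betw_def RCOSETS_def)
  then show thesis using that by auto
qed

lemma \<theta>_value:
  assumes "U \<in> \<S>" "\<xi> \<in> hom_carrier A (tquot P U)"
  obtains c where "c \<in> carrier K" "\<theta> U \<xi> = \<Phi> U #>\<^bsub>K\<^esub> c"
proof -
  have "\<theta> U \<xi> \<in> rcosets\<^bsub>K\<^esub> \<Phi> U"
    using \<theta>_bij[OF assms(1)] assms(2) by (auto simp: bij_betw_def)
  then show thesis using that by (auto simp: RCOSETS_def)
qed

text \<open>One \<xi> with values modulo the intersection serves three instances of
  \<open>mem_\<Phi>_iff\<close>: its values lie in both subgroups exactly when they lie in the
  intersection.\<close>

lemma \<Phi>_Int:
  assumes U: "U\<^sub>1 \<in> \<S>" "U\<^sub>2 \<in> \<S>" and V: "U\<^sub>1 \<inter> U\<^sub>2 \<in> \<S>"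
  shows "\<Phi> (U\<^sub>1 \<inter> U\<^sub>2) = \<Phi> U\<^sub>1 \<inter> \<Phi> U\<^sub>2"
proof
  show "\<Phi> (U\<^sub>1 \<inter> U\<^sub>2) \<subseteq> \<Phi> U\<^sub>1 \<inter> \<Phi> U\<^sub>2"
    using \<Phi>_mono[OF U(1) V] \<Phi>_mono[OF U(2) V] by auto
  show "\<Phi> U\<^sub>1 \<inter> \<Phi> U\<^sub>2 \<subseteq> \<Phi> (U\<^sub>1 \<inter> U\<^sub>2)"
  proof
    fix c assume c: "c \<in> \<Phi> U\<^sub>1 \<inter> \<Phi> U\<^sub>2"
    then have cK: "c \<in> carrier K" using subgroup.subset[OF \<Phi>_subgroup[OF U(1)]] by auto
    obtain \<xi> where \<xi>: "\<xi> \<in> hom_carrier A (tquot P (U\<^sub>1 \<inter> U\<^sub>2))"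
      "\<theta> (U\<^sub>1 \<inter> U\<^sub>2) \<xi> = \<Phi> (U\<^sub>1 \<inter> U\<^sub>2) #>\<^bsub>K\<^esub> c"
      using \<theta>_preimage[OF V cK] .
    show "c \<in> \<Phi> (U\<^sub>1 \<inter> U\<^sub>2)"
      using c mem_\<Phi>_iff[OF U(1) V _ \<xi>(1) cK \<xi>(2)] mem_\<Phi>_iff[OF U(2) V _ \<xi>(1) cK \<xi>(2)]
        mem_\<Phi>_iff[OF V V _ \<xi>(1) cK \<xi>(2)] by auto
  qed
qed

text \<open>Two factorizations of the same coset differ by an element of the intersection, up to
  reordering factors in the abelian quotient. This makes a chosen first factor well defined modulo
  the intersection.\<close>

lemma component_unique:
  assumes U: "U\<^sub>1 \<in> \<S>" "U\<^sub>2 \<in> \<S>" and V: "U\<^sub>1 \<inter> U\<^sub>2 \<in> \<S>"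
    and u: "u \<in> U\<^sub>1" "u' \<in> U\<^sub>1" and w: "w \<in> U\<^sub>2" "w' \<in> U\<^sub>2"
    and eq: "(U\<^sub>1 \<inter> U\<^sub>2) #>\<^bsub>P\<^esub> (u \<otimes>\<^bsub>P\<^esub> w) = (U\<^sub>1 \<inter> U\<^sub>2) #>\<^bsub>P\<^esub> (u' \<otimes>\<^bsub>P\<^esub> w')"
  shows "(U\<^sub>1 \<inter> U\<^sub>2) #>\<^bsub>P\<^esub> u = (U\<^sub>1 \<inter> U\<^sub>2) #>\<^bsub>P\<^esub> u'"
proof -
  interpret U1: subgroup U\<^sub>1 P by (rule S_subgroup[OF U(1)])
  interpret U2: subgroup U\<^sub>2 P by (rule S_subgroup[OF U(2)])
  have c: "u \<in> carrier P" "u' \<in> carrier P" "w \<in> carrier P" "w' \<in> carrier P"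
    using u w by auto
  have "u \<otimes>\<^bsub>P\<^esub> w \<in> (U\<^sub>1 \<inter> U\<^sub>2) #>\<^bsub>P\<^esub> (u' \<otimes>\<^bsub>P\<^esub> w')"
    using eq P.rcos_eq_iff[OF S_subgroup[OF V]] c by simp
  then obtain v where v: "v \<in> U\<^sub>1" "v \<in> U\<^sub>2" "u \<otimes>\<^bsub>P\<^esub> w = v \<otimes>\<^bsub>P\<^esub> (u' \<otimes>\<^bsub>P\<^esub> w')"
    by (auto simp: r_coset_def)
  \<comment> \<open>\<open>z\<close> is the discrepancy in
    \<open>u = (v \<otimes> u') \<otimes> z\<close>. Cancelling in \<open>eq\<close> gives
    \<open>z = w' \<otimes> inv w\<close>, which places \<open>z\<close> in both subgroups.\<close>
  define z where "z = inv\<^bsub>P\<^esub> (v \<otimes>\<^bsub>P\<^esub> u') \<otimes>\<^bsub>P\<^esub> u"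
  have vc: "v \<in> carrier P" using v by auto
  have zc: "z \<in> carrier P" using c vc by (simp add: z_def)
  have zu: "u = (v \<otimes>\<^bsub>P\<^esub> u') \<otimes>\<^bsub>P\<^esub> z"
    using c vc by (simp add: z_def P.m_assoc[symmetric] del: P.inv_mult_group)
  have "(v \<otimes>\<^bsub>P\<^esub> u') \<otimes>\<^bsub>P\<^esub> (z \<otimes>\<^bsub>P\<^esub> w) = (v \<otimes>\<^bsub>P\<^esub> u') \<otimes>\<^bsub>P\<^esub> w'"
    using v(3) zu c vc zc by (metis P.m_assoc P.m_closed)
  then have "z \<otimes>\<^bsub>P\<^esub> w = w'" using c vc zc by simp
  then have "z = w' \<otimes>\<^bsub>P\<^esub> inv\<^bsub>P\<^esub> w"
    using zc c P.inv_solve_right by metis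
  then have "z \<in> U\<^sub>2" using w by simp
  moreover have "z \<in> U\<^sub>1" unfolding z_def using v u by blast
  ultimately have "z \<in> U\<^sub>1 \<inter> U\<^sub>2" by simp
  then have zV: "(U\<^sub>1 \<inter> U\<^sub>2) #>\<^bsub>P\<^esub> z = U\<^sub>1 \<inter> U\<^sub>2" and vV: "(U\<^sub>1 \<inter> U\<^sub>2) #>\<^bsub>P\<^esub> v = U\<^sub>1 \<inter> U\<^sub>2"
    using P.coset_join2[OF _ S_subgroup[OF V]] zc vc v by auto
  have sub: "U\<^sub>1 \<inter> U\<^sub>2 \<subseteq> carrier P" by auto
  \<comment> \<open>\<open>S_comm\<close> moves \<open>z\<close> to the left, where the coset
    absorbs first \<open>z\<close> and then \<open>v\<close>.\<close>
  have "(U\<^sub>1 \<inter> U\<^sub>2) #>\<^bsub>P\<^esub> u = (U\<^sub>1 \<inter> U\<^sub>2) #>\<^bsub>P\<^esub> (z \<otimes>\<^bsub>P\<^esub> (v \<otimes>\<^bsub>P\<^esub> u'))"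
    using zu S_comm[OF V, of "v \<otimes>\<^bsub>P\<^esub> u'" z] c vc zc by simp
  also have "\<dots> = (U\<^sub>1 \<inter> U\<^sub>2) #>\<^bsub>P\<^esub> u'"
    using zV vV c vc zc sub by (metis P.coset_mult_assoc P.m_closed)
  finally show ?thesis .
qed

text \<open>\<open>u\<close> and \<open>w\<close> are mere choices of representatives, with no
  continuity or multiplicativity of their own. Continuity of the coset of \<open>u d\<close> comes
  from compactness through \<open>continuous_map_coset_component\<close>, multiplicativity from
  \<open>component_unique\<close>.\<close>

lemma component_mem_hom_carrier:
  assumes U: "U\<^sub>1 \<in> \<S>" "U\<^sub>2 \<in> \<S>" and V: "U\<^sub>1 \<inter> U\<^sub>2 \<in> \<S>"
    and \<xi>: "\<xi> \<in> hom_carrier A (tquot P (U\<^sub>1 \<inter> U\<^sub>2))"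
    and uw: "\<And>d. d \<in> carrier A \<Longrightarrow>
      u d \<in> U\<^sub>1 \<and> w d \<in> U\<^sub>2 \<and> \<xi> d = (U\<^sub>1 \<inter> U\<^sub>2) #>\<^bsub>P\<^esub> (u d \<otimes>\<^bsub>P\<^esub> w d)"
  shows "(\<lambda>d\<in>carrier A. (U\<^sub>1 \<inter> U\<^sub>2) #>\<^bsub>P\<^esub> u d) \<in> hom_carrier A (tquot P (U\<^sub>1 \<inter> U\<^sub>2))"
proof (rule hom_carrierI[OF V])
  let ?V = "U\<^sub>1 \<inter> U\<^sub>2"
  interpret A: group A using A by (simp add: topological_group_def)
  interpret U1: subgroup U\<^sub>1 P by (rule S_subgroup[OF U(1)])
  interpret U2: subgroup U\<^sub>2 P by (rule S_subgroup[OF U(2)])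
  have "continuous_map (topo A) (coset_topology P ?V) \<xi>"
    using \<xi> by (simp add: hom_carrier_def TAb_mor_def)
  then have "continuous_map (topo A) (coset_topology P ?V) (\<lambda>d. ?V #>\<^bsub>P\<^esub> (u d \<otimes>\<^bsub>P\<^esub> w d))"
    by (rule continuous_map_eq) (use uw A_topspace in auto)
  moreover have "u d \<in> U\<^sub>1" "w d \<in> U\<^sub>2" if "d \<in> topspace (topo A)" for d
    using uw that A_topspace by auto
  ultimately show "continuous_map (topo A) (coset_topology P ?V) (\<lambda>d. ?V #>\<^bsub>P\<^esub> u d)"
    using continuous_map_coset_component[OF P S_subgroup[OF U(1)] S_closed[OF U(1)]
        S_subgroup[OF U(2)] S_closed[OF U(2)] refl S_normal[OF V], of "topo A" u w] by blast
  fix x y assume x: "x \<in> carrier A" and y: "y \<in> carrier A"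
  have c: "u x \<in> carrier P" "u y \<in> carrier P" "w x \<in> carrier P" "w y \<in> carrier P"
    using uw[OF x] uw[OF y] by auto
  have "?V #>\<^bsub>P\<^esub> (u (x \<otimes>\<^bsub>A\<^esub> y) \<otimes>\<^bsub>P\<^esub> w (x \<otimes>\<^bsub>A\<^esub> y)) = \<xi> (x \<otimes>\<^bsub>A\<^esub> y)"
    using uw x y by simp
  also have "\<dots> = \<xi> x <#>\<^bsub>P\<^esub> \<xi> y"
    using \<xi> x y by (simp add: hom_carrier_def TAb_mor_def hom_def)
  also have "\<dots> = ?V #>\<^bsub>P\<^esub> ((u x \<otimes>\<^bsub>P\<^esub> w x) \<otimes>\<^bsub>P\<^esub> (u y \<otimes>\<^bsub>P\<^esub> w y))"
    using uw[OF x] uw[OF y] c rcos_mult[OF V] by simp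
  \<comment> \<open>The product of two factorizations is regrouped by swapping its two inner factors
    in the abelian quotient, so that it again has a first part in \<open>U\<^sub>1\<close> and a
    second in \<open>U\<^sub>2\<close>.\<close>
  also have "\<dots> = (?V #>\<^bsub>P\<^esub> u x) <#>\<^bsub>P\<^esub> ((?V #>\<^bsub>P\<^esub> (w x \<otimes>\<^bsub>P\<^esub> u y)) <#>\<^bsub>P\<^esub> (?V #>\<^bsub>P\<^esub> w y))"
    using c rcos_mult[OF V] by (simp add: P.m_assoc)
  also have "\<dots> = (?V #>\<^bsub>P\<^esub> u x) <#>\<^bsub>P\<^esub> ((?V #>\<^bsub>P\<^esub> (u y \<otimes>\<^bsub>P\<^esub> w x)) <#>\<^bsub>P\<^esub> (?V #>\<^bsub>P\<^esub> w y))"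
    using S_comm[OF V c(3) c(2)] by simp
  also have "\<dots> = ?V #>\<^bsub>P\<^esub> ((u x \<otimes>\<^bsub>P\<^esub> u y) \<otimes>\<^bsub>P\<^esub> (w x \<otimes>\<^bsub>P\<^esub> w y))"
    using c rcos_mult[OF V] by (simp add: P.m_assoc)
  finally have eq: "?V #>\<^bsub>P\<^esub> (u (x \<otimes>\<^bsub>A\<^esub> y) \<otimes>\<^bsub>P\<^esub> w (x \<otimes>\<^bsub>A\<^esub> y)) =
      ?V #>\<^bsub>P\<^esub> ((u x \<otimes>\<^bsub>P\<^esub> u y) \<otimes>\<^bsub>P\<^esub> (w x \<otimes>\<^bsub>P\<^esub> w y))" .
  have "u x \<otimes>\<^bsub>P\<^esub> u y \<in> U\<^sub>1" "w x \<otimes>\<^bsub>P\<^esub> w y \<in> U\<^sub>2" "u (x \<otimes>\<^bsub>A\<^esub> y) \<in> U\<^sub>1" "w (x \<otimes>\<^bsub>A\<^esub> y) \<in> U\<^sub>2"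
    using uw[OF x] uw[OF y] uw[OF A.m_closed[OF x y]] by blast+
  from component_unique[OF U V this(3,1,4,2) eq]
  have "?V #>\<^bsub>P\<^esub> u (x \<otimes>\<^bsub>A\<^esub> y) = ?V #>\<^bsub>P\<^esub> (u x \<otimes>\<^bsub>P\<^esub> u y)" .
  then show "?V #>\<^bsub>P\<^esub> u (x \<otimes>\<^bsub>A\<^esub> y) = (?V #>\<^bsub>P\<^esub> u x) <#>\<^bsub>P\<^esub> (?V #>\<^bsub>P\<^esub> u y)"
    using rcos_mult[OF V] c by simp
qed

text \<open>Monotonicity gives one inclusion. For the other, the two factors of \<xi> have values in
  \<open>U\<^sub>1\<close> and \<open>U\<^sub>2\<close>, so the elements \<open>c1\<close> and
  \<open>c2\<close> representing their images under \<theta> lie in \<open>\<Phi> U\<^sub>1\<close>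
  and \<open>\<Phi> U\<^sub>2\<close>.\<close>

lemma \<Phi>_set_mult:
  assumes U: "U\<^sub>1 \<in> \<S>" "U\<^sub>2 \<in> \<S>" and V: "U\<^sub>1 \<inter> U\<^sub>2 \<in> \<S>" and W: "U\<^sub>1 <#>\<^bsub>P\<^esub> U\<^sub>2 \<in> \<S>"
  shows "\<Phi> (U\<^sub>1 <#>\<^bsub>P\<^esub> U\<^sub>2) = \<Phi> U\<^sub>1 <#>\<^bsub>K\<^esub> \<Phi> U\<^sub>2"
proof
  let ?V = "U\<^sub>1 \<inter> U\<^sub>2" and ?W = "U\<^sub>1 <#>\<^bsub>P\<^esub> U\<^sub>2"
  interpret U1: subgroup U\<^sub>1 P by (rule S_subgroup[OF U(1)])
  interpret U2: subgroup U\<^sub>2 P by (rule S_subgroup[OF U(2)])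
  interpret F1: subgroup "\<Phi> U\<^sub>1" K by (rule \<Phi>_subgroup[OF U(1)])
  interpret F2: subgroup "\<Phi> U\<^sub>2" K by (rule \<Phi>_subgroup[OF U(2)])
  have U1W: "U\<^sub>1 \<subseteq> ?W"
    by (rule P.subset_set_mult(1)[OF U1.subgroup_axioms U2.subgroup_axioms])
  have U2W: "U\<^sub>2 \<subseteq> ?W"
    by (rule P.subset_set_mult(2)[OF U1.subgroup_axioms U2.subgroup_axioms])
  have VW: "?V \<subseteq> ?W" using U1W by auto
  show "\<Phi> U\<^sub>1 <#>\<^bsub>K\<^esub> \<Phi> U\<^sub>2 \<subseteq> \<Phi> ?W"
    using \<Phi>_mono[OF W U(1) U1W] \<Phi>_mono[OF W U(2) U2W] subgroup.m_closed[OF \<Phi>_subgroup[OF W]]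
    by (auto simp: set_mult_def)
  show "\<Phi> ?W \<subseteq> \<Phi> U\<^sub>1 <#>\<^bsub>K\<^esub> \<Phi> U\<^sub>2"
  proof
    fix c assume c: "c \<in> \<Phi> ?W"
    then have cK: "c \<in> carrier K" using subgroup.subset[OF \<Phi>_subgroup[OF W]] by auto
    obtain \<xi> where \<xi>: "\<xi> \<in> hom_carrier A (tquot P ?V)" "\<theta> ?V \<xi> = \<Phi> ?V #>\<^bsub>K\<^esub> c"
      using \<theta>_preimage[OF V cK] .
    have \<xi>W: "\<forall>d\<in>carrier A. \<xi> d \<subseteq> ?W"
      using mem_\<Phi>_iff[OF W V VW \<xi>(1) cK \<xi>(2)] c by simp
    have "\<exists>u w. u \<in> U\<^sub>1 \<and> w \<in> U\<^sub>2 \<and> \<xi> d = ?V #>\<^bsub>P\<^esub> (u \<otimes>\<^bsub>P\<^esub> w)" if d: "d \<in> carrier A" for d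
    proof -
      obtain x where x: "x \<in> carrier P" "\<xi> d = ?V #>\<^bsub>P\<^esub> x"
        using hom_carrier_coset[OF \<xi>(1) d] by (auto simp: RCOSETS_def)
      have "x \<in> ?W"
        using \<xi>W d x P.rcos_self[OF x(1) S_subgroup[OF V]] by auto
      then show ?thesis using x by (auto simp: set_mult_def)
    qed
    then obtain u w where uw: "\<And>d. d \<in> carrier A \<Longrightarrow>
        u d \<in> U\<^sub>1 \<and> w d \<in> U\<^sub>2 \<and> \<xi> d = ?V #>\<^bsub>P\<^esub> (u d \<otimes>\<^bsub>P\<^esub> w d)"
      by metis
    have uwc: "u d \<in> carrier P" "w d \<in> carrier P" if "d \<in> carrier A" for d
      using uw[OF that] by auto
    define \<xi>1 where "\<xi>1 = (\<lambda>d\<in>carrier A. ?V #>\<^bsub>P\<^esub> u d)"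
    define \<xi>2 where "\<xi>2 = (\<lambda>d\<in>carrier A. ?V #>\<^bsub>P\<^esub> w d)"
    have h1: "\<xi>1 \<in> hom_carrier A (tquot P ?V)"
      unfolding \<xi>1_def using component_mem_hom_carrier[OF U V \<xi>(1) uw] .
    \<comment> \<open>The component lemma treats first factors, so it is applied with the roles of
      the subgroups exchanged; \<open>S_comm\<close> rewrites \<open>u d \<otimes> w d\<close> as
      \<open>w d \<otimes> u d\<close> modulo the intersection.\<close>
    have "(\<lambda>d\<in>carrier A. (U\<^sub>2 \<inter> U\<^sub>1) #>\<^bsub>P\<^esub> w d) \<in> hom_carrier A (tquot P (U\<^sub>2 \<inter> U\<^sub>1))"
      using U V \<xi>(1) uw S_comm[OF V] uwc
      by (intro component_mem_hom_carrier[where \<xi> = \<xi> and w = u]) (auto simp: Int_commute)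
    then have h2: "\<xi>2 \<in> hom_carrier A (tquot P ?V)"
      by (simp add: \<xi>2_def Int_commute)
    obtain c1 where c1: "c1 \<in> carrier K" "\<theta> ?V \<xi>1 = \<Phi> ?V #>\<^bsub>K\<^esub> c1"
      using \<theta>_value[OF V h1] .
    obtain c2 where c2: "c2 \<in> carrier K" "\<theta> ?V \<xi>2 = \<Phi> ?V #>\<^bsub>K\<^esub> c2"
      using \<theta>_value[OF V h2] .
    have "\<forall>d\<in>carrier A. \<xi>1 d \<subseteq> U\<^sub>1"
      using uw by (auto simp: \<xi>1_def r_coset_def)
    then have c1m: "c1 \<in> \<Phi> U\<^sub>1"
      using mem_\<Phi>_iff[OF U(1) V _ h1 c1] by auto
    have "\<forall>d\<in>carrier A. \<xi>2 d \<subseteq> U\<^sub>2"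
      using uw by (auto simp: \<xi>2_def r_coset_def)
    then have c2m: "c2 \<in> \<Phi> U\<^sub>2"
      using mem_\<Phi>_iff[OF U(2) V _ h2 c2] by auto
    have "\<xi> = (\<lambda>d\<in>carrier A. \<xi>1 d <#>\<^bsub>P\<^esub> \<xi>2 d)"
    proof (rule extensionalityI[of _ "carrier A"])
      show "\<xi> \<in> extensional (carrier A)" using \<xi> by (simp add: hom_carrier_def)
    qed (use uw uwc rcos_mult[OF V] in \<open>auto simp: \<xi>1_def \<xi>2_def\<close>)
    then have "\<Phi> ?V #>\<^bsub>K\<^esub> c = (\<Phi> ?V #>\<^bsub>K\<^esub> c1) <#>\<^bsub>K\<^esub> (\<Phi> ?V #>\<^bsub>K\<^esub> c2)"
      using \<theta>_mult[OF V h1 h2] \<xi> c1 c2 by simp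
    also have "\<dots> = \<Phi> ?V #>\<^bsub>K\<^esub> (c1 \<otimes>\<^bsub>K\<^esub> c2)"
      using normal.rcos_sum[OF K.subgroup_imp_normal[OF \<Phi>_subgroup[OF V]]] c1 c2 by simp
    finally have "c \<in> \<Phi> ?V #>\<^bsub>K\<^esub> (c1 \<otimes>\<^bsub>K\<^esub> c2)"
      using K.rcos_eq_iff[OF \<Phi>_subgroup[OF V]] cK c1 c2 by simp
    then obtain v where v: "v \<in> \<Phi> ?V" "c = v \<otimes>\<^bsub>K\<^esub> (c1 \<otimes>\<^bsub>K\<^esub> c2)"
      by (auto simp: r_coset_def)
    \<comment> \<open>The error \<open>v\<close> between \<open>c\<close> and
      \<open>c1 \<otimes> c2\<close> comes from \<open>\<Phi> ?V\<close>, hence can be absorbed into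
      the factor from \<open>\<Phi> U\<^sub>1\<close>.\<close>
    have v1: "v \<in> \<Phi> U\<^sub>1" using v \<Phi>_mono[OF U(1) V] by auto
    then have "c = (v \<otimes>\<^bsub>K\<^esub> c1) \<otimes>\<^bsub>K\<^esub> c2"
      using v c1 c2 by (simp add: K.m_assoc)
    then show "c \<in> \<Phi> U\<^sub>1 <#>\<^bsub>K\<^esub> \<Phi> U\<^sub>2"
      using v1 c1m c2m by (auto simp: set_mult_def)
  qed
qed

section \<open>Homomorphisms into U/V and injectivity\<close>

text \<open>A homomorphism into U/V, regarded as one into P/V, has values in \<open>U\<close>, so
  its associated \<open>c\<close> lies in \<open>\<Phi> U\<close>. As this is
  \<open>\<Phi> V\<close>, the criterion at \<open>V\<close> itself forces the values into
  \<open>V\<close>. The conclusion is the hypothesis of condition (2) of L-coherence.\<close>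

lemma trivial_TAb_Hom:
  assumes U: "U \<in> \<S>" and V: "V \<in> \<S>" and VU: "V \<subseteq> U" and eq: "\<Phi> U = \<Phi> V"
  shows "hom_carrier A (tquot (subtgrp P U) V) = {\<lambda>d\<in>carrier A. V}"
proof
  interpret A: group A using A by (simp add: topological_group_def)
  interpret U: subgroup U P by (rule S_subgroup[OF U])
  interpret V: subgroup V P by (rule S_subgroup[OF V])
  have rc: "rcosets\<^bsub>subtgrp P U\<^esub> V = (\<lambda>x. V #>\<^bsub>P\<^esub> x) ` U"
    by (auto simp: RCOSETS_def r_coset_def)
  show "hom_carrier A (tquot (subtgrp P U) V) \<subseteq> {\<lambda>d\<in>carrier A. V}"
  proof
    fix \<xi> assume \<xi>: "\<xi> \<in> hom_carrier A (tquot (subtgrp P U) V)"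
    have ext: "\<xi> \<in> extensional (carrier A)" using \<xi> by (simp add: hom_carrier_def)
    have cU: "\<xi> d \<in> (\<lambda>x. V #>\<^bsub>P\<^esub> x) ` U" if "d \<in> carrier A" for d
      using \<xi> that rc by (auto simp: hom_carrier_def TAb_mor_def hom_def)
    have cont: "continuous_map (topo A) (coset_topology (subtgrp P U) V) \<xi>"
      using \<xi> by (simp add: hom_carrier_def TAb_mor_def)
    have "continuous_map (topo A) (coset_topology P V) \<xi>"
      unfolding continuous_map_def S_topspace[OF V] A_topspace
    proof (intro conjI allI impI)
      show "\<xi> \<in> carrier A \<rightarrow> rcosets\<^bsub>P\<^esub> V"
        using cU by (fastforce simp: RCOSETS_def)
      fix W assume "openin (coset_topology P V) W"
      then have oW: "openin (topo P) {x \<in> carrier P. V #>\<^bsub>P\<^esub> x \<in> W}"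
        by (simp add: openin_coset_topology)
      \<comment> \<open>The inclusion of U/V in P/V is continuous: the preimage in \<open>U\<close>
        of an open set is the trace on \<open>U\<close> of its preimage in \<open>P\<close>.\<close>
      have "{x \<in> U. V #>\<^bsub>P\<^esub> x \<in> W \<inter> (\<lambda>x. V #>\<^bsub>P\<^esub> x) ` U} =
          {x \<in> carrier P. V #>\<^bsub>P\<^esub> x \<in> W} \<inter> U"
        by auto
      then have "openin (coset_topology (subtgrp P U) V) (W \<inter> (\<lambda>x. V #>\<^bsub>P\<^esub> x) ` U)"
        using oW unfolding openin_coset_topology rc
        by (auto simp: openin_subtopology r_coset_def)
      then have "openin (topo A) {d \<in> carrier A. \<xi> d \<in> W \<inter> (\<lambda>x. V #>\<^bsub>P\<^esub> x) ` U}"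
        using cont unfolding continuous_map_def A_topspace by blast
      moreover have "{d \<in> carrier A. \<xi> d \<in> W \<inter> (\<lambda>x. V #>\<^bsub>P\<^esub> x) ` U} = {d \<in> carrier A. \<xi> d \<in> W}"
        using cU by auto
      ultimately show "openin (topo A) {d \<in> carrier A. \<xi> d \<in> W}" by simp
    qed
    then have "restrict \<xi> (carrier A) \<in> hom_carrier A (tquot P V)"
      by (rule hom_carrierI[OF V])
        (use \<xi> in \<open>auto simp: hom_carrier_def TAb_mor_def hom_def\<close>)
    then have \<xi>V: "\<xi> \<in> hom_carrier A (tquot P V)"
      using ext by (simp add: extensional_restrict)
    obtain c where c: "c \<in> carrier K" "\<theta> V \<xi> = \<Phi> V #>\<^bsub>K\<^esub> c"
      using \<theta>_value[OF V \<xi>V] .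
    have "\<xi> d \<subseteq> U" if "d \<in> carrier A" for d
      using cU[OF that] subsetD[OF VU] U.m_closed by (auto simp: r_coset_def)
    then have "c \<in> \<Phi> V" using mem_\<Phi>_iff[OF U V VU \<xi>V c] eq by simp
    then have "\<xi> d \<subseteq> V" if "d \<in> carrier A" for d
      using mem_\<Phi>_iff[OF V V order_refl \<xi>V c] that by simp
    moreover have "\<xi> d = V" if d: "d \<in> carrier A" and sub: "\<xi> d \<subseteq> V" for d
    proof -
      obtain x where x: "x \<in> U" "\<xi> d = V #>\<^bsub>P\<^esub> x" using cU[OF d] by blast
      have "x \<in> V"
        using sub P.rcos_self[OF U.mem_carrier[OF x(1)] V.subgroup_axioms] unfolding x(2) by blast
      then show ?thesis
        unfolding x(2) by (rule P.coset_join2[OF U.mem_carrier[OF x(1)] V.subgroup_axioms])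
    qed
    ultimately have "\<xi> = (\<lambda>d\<in>carrier A. V)"
      using ext by (intro extensionalityI[of _ "carrier A"]) auto
    then show "\<xi> \<in> {\<lambda>d\<in>carrier A. V}" by simp
  qed
  \<comment> \<open>L-coherence phrases triviality as equality of the carrier with a singleton, so
    the constant map has to be a member of it.\<close>
  have VV: "V \<in> rcosets\<^bsub>subtgrp P U\<^esub> V"
    unfolding rc using imageI[OF U.one_closed, of "\<lambda>x. V #>\<^bsub>P\<^esub> x"] V.subset by simp
  have "topspace (coset_topology (subtgrp P U) V) = rcosets\<^bsub>subtgrp P U\<^esub> V"
    using topspace_coset_topology[OF topological_group_subtgrp[OF P(1) U.subgroup_axioms]] VU
    by simp
  then have "continuous_map (topo A) (coset_topology (subtgrp P U) V) (\<lambda>d. V)"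
    using VV by simp
  then have "continuous_map (topo A) (coset_topology (subtgrp P U) V) (\<lambda>d\<in>carrier A. V)"
    by (rule continuous_map_eq) (simp add: A_topspace)
  moreover have "(\<lambda>d\<in>carrier A. V) \<in> hom A (tquot (subtgrp P U) V)"
    using VV P.subgroup_mult_id[OF V.subgroup_axioms] by (simp add: hom_def)
  ultimately show "{\<lambda>d\<in>carrier A. V} \<subseteq> hom_carrier A (tquot (subtgrp P U) V)"
    by (simp add: hom_carrier_def TAb_mor_def)
qed

end

section \<open>From RIC-functors to the fixed-group setting\<close>

lemma rcos_commute:
  assumes N: "N \<lhd> P" and comm: "comm_group (tquot P N)"
    and M: "subgroup M P" "N \<subseteq> M" and x: "x \<in> carrier P" and y: "y \<in> carrier P"
  shows "M #>\<^bsub>P\<^esub> (x \<otimes>\<^bsub>P\<^esub> y) = M #>\<^bsub>P\<^esub> (y \<otimes>\<^bsub>P\<^esub> x)"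
proof -
  interpret N: normal N P by (rule N)
  interpret Q: comm_group "tquot P N" by (rule comm)
  have "(N #>\<^bsub>P\<^esub> x) <#>\<^bsub>P\<^esub> (N #>\<^bsub>P\<^esub> y) = (N #>\<^bsub>P\<^esub> y) <#>\<^bsub>P\<^esub> (N #>\<^bsub>P\<^esub> x)"
    using Q.m_comm[of "N #>\<^bsub>P\<^esub> x" "N #>\<^bsub>P\<^esub> y"] N.rcosetsI[OF N.subset] x y by simp
  then have "N #>\<^bsub>P\<^esub> (x \<otimes>\<^bsub>P\<^esub> y) = N #>\<^bsub>P\<^esub> (y \<otimes>\<^bsub>P\<^esub> x)"
    using x y by (simp add: N.rcos_sum)
  \<comment> \<open>Left multiplication by \<open>M\<close> projects this identity from cosets of
    \<open>N\<close> to cosets of \<open>M\<close>.\<close>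
  then show ?thesis
    using N.set_mult_rcos_absorb[OF N.subgroup_axioms M] x y by (metis N.m_closed)
qed

lemma RIC_functor_TAb: "\<lbrakk>RIC_functor G D F; x \<in> pts D\<rbrakk> \<Longrightarrow> TAb (Fobj F x)"
  by (simp add: RIC_functor_def)

lemma RIC_functor_Find_self:
  "\<lbrakk>RIC_functor G D F; x \<in> pts D; a \<in> carrier (Fobj F x)\<rbrakk> \<Longrightarrow> Find F x x a = a"
  by (simp add: RIC_functor_def)

lemma RIC_mor_hom: "\<lbrakk>\<phi> \<in> RIC_mor G D F F'; x \<in> pts D\<rbrakk> \<Longrightarrow> \<phi> x \<in> hom (Fobj F x) (Fobj F' x)"
  by (simp add: RIC_mor_def TAb_mor_def)

lemma RIC_mor_Find:
  "\<lbrakk>\<phi> \<in> RIC_mor G D F F'; x \<in> pts D; y \<in> iset D x; a \<in> carrier (Fobj F y)\<rbrakk>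
    \<Longrightarrow> \<phi> x (Find F x y a) = Find F' x y (\<phi> y a)"
  by (simp add: RIC_mor_def)

lemma RIC_iso_imp_mor: "\<phi> \<in> RIC_iso G D F F' \<Longrightarrow> \<phi> \<in> RIC_mor G D F F'"
  by (simp add: RIC_iso_def)

lemma RIC_iso_bij_betw:
  assumes "\<phi> \<in> RIC_iso G D F F'" and x: "x \<in> pts D"
  shows "bij_betw (\<phi> x) (carrier (Fobj F x)) (carrier (Fobj F' x))"
proof -
  obtain \<psi> where \<phi>: "\<phi> \<in> RIC_mor G D F F'" and \<psi>: "\<psi> \<in> RIC_mor G D F' F"
    and inv: "\<forall>x\<in>pts D. (\<forall>a\<in>carrier (Fobj F x). \<psi> x (\<phi> x a) = a) \<and>
      (\<forall>b\<in>carrier (Fobj F' x). \<phi> x (\<psi> x b) = b)"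
    using assms(1) by (auto simp: RIC_iso_def)
  show ?thesis
    using RIC_mor_hom[OF \<phi> x] RIC_mor_hom[OF \<psi> x] inv x
    by (intro bij_betwI[where g = "\<psi> x"]) (auto simp: hom_def)
qed

text \<open>For U containing R(H) the product \<open>U <#> R H\<close> is U, so
  \<open>Pi_functor\<close> takes the value H/U at (H, U). Condition (1) of L-coherence supplies the
  induction from (H, V) to (H, U), whose naturality square for \<theta> gives the last assumption of
  the locale.\<close>

lemma coset_classification_Ext_R:
  fixes C :: "('g, 'g set, 'c) ric_functor" and D :: "('g, 'g set, 'd) ric_functor"
  assumes G: "topological_group G" "compact_space (topo G)" "Hausdorff_space (topo G)"
    and datum: "coabelian_classification_datum G E R D"
    and coh: "L_coherent G E R D"
    and rep: "is_representation G E C \<Phi>"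
    and iso: "\<theta> \<in> RIC_iso G E (hom_functor E (inflate D) (Pi_functor G R))
                          (quotient_functor E (inflate C) \<Phi>)"
    and H: "H \<in> pts (flat G E)"
  shows "coset_classification (subtgrp G H) (Fobj C H) (Fobj D H) (Ext_R R E H)
    (\<lambda>U. \<Phi> (H, U)) (\<lambda>U. \<theta> (H, U))"
proof -
  let ?P = "subtgrp G H" and ?K = "Fobj C H" and ?A = "Fobj D H"
  let ?F = "hom_functor E (inflate D) (Pi_functor G R)"
  let ?Q = "quotient_functor E (inflate C) \<Phi>"
  have E: "subgroup_system2 G E" and ab: "abelianization_system G (flat G E) R"
    and D: "RIC_functor G (flat G E) D"
    using datum by (auto simp: coabelian_classification_datum_def spectrum_def
        dualizing_functor_def)
  have C: "RIC_functor G (flat G E) C" and sf: "subfunctor G E (inflate C) \<Phi>"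
    using rep by (auto simp: is_representation_def)
  have Grp2: "(H, U) \<in> Grp2 G" if "(H, U) \<in> pts E" for U
    using E that by (auto simp: subgroup_system2_def)
  obtain U\<^sub>0 where "(H, U\<^sub>0) \<in> pts E" using H by (auto simp: flat_def)
  then have HG: "subgroup H G" and Hcl: "closedin (topo G) H"
    using Grp2 by (auto simp: Grp2_def)
  have P: "topological_group ?P" by (rule topological_group_subtgrp[OF G(1) HG])
  interpret P: group ?P using P by (simp add: topological_group_def)
  have Pc: "compact_space (topo ?P)"
    using closedin_compact_space[OF G(2) Hcl] by (simp add: compact_space_subtopology)
  have Ph: "Hausdorff_space (topo ?P)" using G(3) by (simp add: Hausdorff_space_subtopology)
  note idC = RIC_functor_Find_self[OF C H] and idD = RIC_functor_Find_self[OF D H]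
  have "TAb ?K" by (rule RIC_functor_TAb[OF C H])
  then interpret K: comm_group ?K by (simp add: TAb_def)
  have A: "topological_group ?A" using RIC_functor_TAb[OF D H] by (simp add: TAb_def)
  have RN: "R H \<lhd> ?P" and Rcomm: "comm_group (tquot ?P (R H))"
    using ab H unfolding abelianization_system_def by blast+
  interpret R: normal "R H" ?P by (rule RN)
  have pts: "(H, U) \<in> pts E" and RU: "R H \<subseteq> U" if "U \<in> Ext_R R E H" for U
    using that by (auto simp: Ext_R_def Ext_def)
  have norm: "U \<lhd> ?P" and clG: "closedin (topo G) U" if "U \<in> Ext_R R E H" for U
    using Grp2[OF pts[OF that]] by (auto simp: Grp2_def)
  have sgr: "subgroup U ?P" if "U \<in> Ext_R R E H" for U
    using norm[OF that] normal_imp_subgroup by blast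
  have UR: "U <#>\<^bsub>G\<^esub> R H = U" if U: "U \<in> Ext_R R E H" for U
  proof -
    have "U <#>\<^bsub>?P\<^esub> R H = U"
    proof
      show "U <#>\<^bsub>?P\<^esub> R H \<subseteq> U"
        using RU[OF U] subgroup.m_closed[OF sgr[OF U]] by (auto simp: set_mult_def)
      show "U \<subseteq> U <#>\<^bsub>?P\<^esub> R H"
        by (rule P.subset_set_mult(1)[OF sgr[OF U] R.subgroup_axioms])
    qed
    then show ?thesis by simp
  qed
  have iset: "(H, V) \<in> iset E (H, U)" if "U \<in> Ext_R R E H" "V \<in> Ext_R R E H" "V \<subseteq> U" for U V
    using coh H that unfolding L_coherent_def by blast
  have subK: "subgroup (\<Phi> (H, U)) ?K" if "U \<in> Ext_R R E H" for U
    using sf pts[OF that] unfolding subfunctor_def inflate_def by fastforce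
  have FobjF: "Fobj ?F (H, U) = TAb_Hom ?A (tquot ?P U)" if "U \<in> Ext_R R E H" for U
    by (simp add: hom_functor_def inflate_def Pi_functor_def UR[OF that])
  have FobjQ: "Fobj ?Q (H, U) = tquot ?K (\<Phi> (H, U))" for U
    by (simp add: quotient_functor_def inflate_def)
  have carF: "carrier (Fobj ?F (H, U)) = hom_carrier ?A (tquot ?P U)" if "U \<in> Ext_R R E H" for U
    by (simp add: FobjF[OF that] TAb_Hom_def)
  have carQ: "carrier (Fobj ?Q (H, U)) = rcosets\<^bsub>?K\<^esub> \<Phi> (H, U)" for U
    by (simp add: FobjQ)
  note mor = RIC_iso_imp_mor[OF iso] and bij = RIC_iso_bij_betw[OF iso]
  show ?thesis
  proof (intro coset_classification.intro P.is_group K.comm_group_axioms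
      coset_classification_axioms.intro, goal_cases)
    case (5 U) show ?case by (rule norm[OF 5])
  next
    case (6 U)
    then show ?case
      using clG subgroup.subset[OF sgr] by (auto intro: closedin_subset_topspace)
  next
    case (7 U x y)
    then show ?case using rcos_commute[OF RN Rcomm sgr RU] by blast
  next
    case (8 U) then show ?case by (rule subK)
  next
    case (9 U V)
    \<comment> \<open>Stability of \<Phi> under the induction, which on first components is the
      identity of C(H).\<close>
    have "Find C H H ` \<Phi> (H, V) \<subseteq> \<Phi> (H, U)"
      using sf pts[OF 9(1)] iset[OF 9] unfolding subfunctor_def inflate_def by fastforce
    then show ?case using idC subgroup.subset[OF subK[OF 9(2)]] by force
  next
    case (10 U) then show ?case using RIC_mor_hom[OF mor pts] FobjF FobjQ by metis
  next
    case (11 U) then show ?case using bij[OF pts] carF carQ by metis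
  next
    case (12 U V \<xi>)
    \<comment> \<open>\<open>Find C H H\<close> is known to be the identity only on the carrier, so
      the coset has to be located there.\<close>
    have sub: "\<theta> (H, V) \<xi> \<subseteq> carrier ?K"
      using bij_betwE[OF bij[OF pts[OF 12(2)]]] 12(4) carF[OF 12(2)] carQ
        subgroup.rcosets_carrier[OF subK[OF 12(2)] K.is_group] by blast
    have "\<theta> (H, U) (Find ?F (H, U) (H, V) \<xi>) = Find ?Q (H, U) (H, V) (\<theta> (H, V) \<xi>)"
      using RIC_mor_Find[OF mor pts[OF 12(1)] iset[OF 12(1-3)]] 12(4) carF[OF 12(2)] by simp
    moreover have "Find ?Q (H, U) (H, V) (\<theta> (H, V) \<xi>) = \<Phi> (H, U) <#>\<^bsub>?K\<^esub> \<theta> (H, V) \<xi>"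
    proof -
      have "Find C H H ` \<theta> (H, V) \<xi> = \<theta> (H, V) \<xi>" using idC sub by force
      then show ?thesis by (simp add: quotient_functor_def quot_map_def inflate_def)
    qed
    moreover have "Find ?F (H, U) (H, V) \<xi> = (\<lambda>d\<in>carrier ?A. U <#>\<^bsub>?P\<^esub> \<xi> d)"
    proof -
      \<comment> \<open>The Hom functor precomposes with the inverse of the structure map of D, here
        the inverse of the identity on D(H).\<close>
      have "inv_into (carrier ?A) (Find D H H) d = d" if "d \<in> carrier ?A" for d
        using inv_into_f_f[of "Find D H H" "carrier ?A" d] that idD by (simp add: inj_on_def)
      then show ?thesis
        by (auto simp: hom_functor_def Pi_functor_def quot_map_def inflate_def UR[OF 12(1)]
            intro!: restrict_ext)
    qed
    ultimately show ?case by simp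
  qed (use P Pc Ph A in simp_all)
qed

section \<open>R-lattices over an arbitrary \<open>H\<close>\<close>

theorem corollary3p4p15:
  fixes G :: "'g topgrp"
    and E :: "'g ric_domain2"
    and R :: "'g set \<Rightarrow> 'g set"
    and D :: "('g, 'g set, 'd) ric_functor"
    and C :: "('g, 'g set, 'c) ric_functor"
    and \<Phi> :: "'g set \<times> 'g set \<Rightarrow> 'c set"
    and \<theta> :: "'g set \<times> 'g set \<Rightarrow> ('d \<Rightarrow> 'g set) \<Rightarrow> 'c set"
  assumes "topological_group G"
    and "compact_space (topo G)" and "Hausdorff_space (topo G)"
    and "coabelian_classification_datum G E R D"
    and "L_coherent G E R D"
    and "is_representation G E C \<Phi>"
    and "\<theta> \<in> RIC_iso G E (hom_functor E (inflate D) (Pi_functor G R))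
                          (quotient_functor E (inflate C) \<Phi>)"
  shows "class_field_theory G E R D C \<Phi> \<theta>"
  unfolding class_field_theory_def
proof (intro conjI allI impI ballI assms(6,7))
  fix L H assume L: "R_lattice G E R L" and H: "H \<in> pts (flat G E)"
  interpret coset_classification "subtgrp G H" "Fobj C H" "Fobj D H" "Ext_R R E H"
    "\<lambda>U. \<Phi> (H, U)" "\<lambda>U. \<theta> (H, U)"
    using coset_classification_Ext_R[OF assms H] .
  have sub: "U \<in> Ext_R R E H" if "U \<in> L H" for U
    using L H that unfolding R_lattice_def by blast
  have Int: "U \<inter> V \<in> L H" and prod: "U <#>\<^bsub>G\<^esub> V \<in> L H" if "U \<in> L H" "V \<in> L H" for U V
    using L H that unfolding R_lattice_def by blast+
  show "subgroup (\<Phi> (H, U)) (Fobj C H)" if "U \<in> L H" for U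
    using \<Phi>_subgroup[OF sub[OF that]] .
  \<comment> \<open>Injectivity for nested members: equal values of \<Phi> make the Hom group into
    U/V trivial, and condition (2) of L-coherence applies.\<close>
  have eqI: "V = U" if U: "U \<in> Ext_R R E H" and V: "V \<in> Ext_R R E H"
    and "V \<subseteq> U" "\<Phi> (H, U) = \<Phi> (H, V)" for U V
  proof -
    have "subtgrp (subtgrp G H) U = subtgrp G U"
      using subtgrp_subtgrp subgroup.subset[OF S_subgroup[OF U]] by simp
    then have "carrier (TAb_Hom (Fobj D H) (tquot (subtgrp G U) V)) =
        {\<one>\<^bsub>TAb_Hom (Fobj D H) (tquot (subtgrp G U) V)\<^esub>}"
      using trivial_TAb_Hom[OF that] by (simp add: TAb_Hom_def)
    then show ?thesis
      using assms(5) H U V \<open>V \<subseteq> U\<close> unfolding L_coherent_def by blast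
  qed
  show "inj_on (\<lambda>U. \<Phi> (H, U)) (L H)"
  proof (rule inj_onI)
    fix U V assume U: "U \<in> L H" and V: "V \<in> L H" and eq: "\<Phi> (H, U) = \<Phi> (H, V)"
    \<comment> \<open>The general case reduces to nested pairs: by compatibility with intersections,
      \<Phi> takes at \<open>U \<inter> V\<close> the common value at \<open>U\<close> and
      \<open>V\<close>, so both coincide with their intersection.\<close>
    note I = sub[OF Int[OF U V]]
    have "\<Phi> (H, U \<inter> V) = \<Phi> (H, U)"
      using \<Phi>_Int[OF sub[OF U] sub[OF V] I] eq by simp
    then show "U = V"
      using eqI[OF sub[OF U] I] eqI[OF sub[OF V] I] eq by auto
  qed
  fix U\<^sub>1 U\<^sub>2 assume U: "U\<^sub>1 \<in> L H" "U\<^sub>2 \<in> L H"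
  note S = sub[OF U(1)] sub[OF U(2)] sub[OF Int[OF U]]
  show "\<Phi> (H, U\<^sub>1 <#>\<^bsub>G\<^esub> U\<^sub>2) = \<Phi> (H, U\<^sub>1) <#>\<^bsub>Fobj C H\<^esub> \<Phi> (H, U\<^sub>2)"
    using \<Phi>_set_mult[OF S] sub[OF prod[OF U]] by simp
  show "\<Phi> (H, U\<^sub>1 \<inter> U\<^sub>2) = \<Phi> (H, U\<^sub>1) \<inter> \<Phi> (H, U\<^sub>2)"
    using \<Phi>_Int[OF S] .
qed

end
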